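(* The conjugacy growth series $\tilde\sigma_{(C_2\wr\mathbb Z,\vec Y)}(z)$ of the Lamplighter group $C_2\wr\mathbb Z$ is transcendental over $\mathbb Q(z)$.
   Context: $C_2\wr\mathbb Z=\bigl(\bigoplus_{i\in\mathbb Z}C_2\bigr)\rtimes\mathbb Z$, where $\mathbb Z=\langle a\rangle$ acts by translation of coordinates: $(\eta,m)(\theta,n)=(\eta\theta^m,mn)$ with $\theta^m(i)=\theta(m^{-1}i)$. The generating set is $\vec Y=\{(\vec e,a),(\vec e,a^{-1}),(\vec y,e')\}$, where $e'$ is the neutral element of $\mathbb Z$, $\vec e$ is the trivial element of $\bigoplus_{i\in\mathbb Z}C_2$, and $\vec y$ has the generator $y$ of $C_2$ at position $e'$ and the trivial element elsewhere. The length of a conjugacy class is the minimum word length (with respect to $\vec Y$) of its elements, and the conjugacy growth series $\tilde\sigma_{(C_2\wr\mathbb Z,\vec Y)}(z)$ is the power series whose coefficient of $z^n$ is the number of conjugacy classes of length $n$. *)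

theory Defs
  imports "HOL-Algebra.Algebra" "HOL-Algebra.Algebraic_Closure_Type"
begin

text \<open>
  The translate of \<open>\<theta>\<close> by \<open>m\<close> has the value \<open>\<theta> (m\<^sup>-\<^sup>1 i)\<close> at \<open>i\<close>. It is restricted to
  the carrier because the elements of \<^const>\<open>sum_group\<close> are extensional functions.
\<close>

definition translate :: "('i, 'c) monoid_scheme \<Rightarrow> 'i \<Rightarrow> ('i \<Rightarrow> 'a) \<Rightarrow> ('i \<Rightarrow> 'a)" where
  "translate Q m \<theta> = (\<lambda>i\<in>carrier Q. \<theta> (inv\<^bsub>Q\<^esub> m \<otimes>\<^bsub>Q\<^esub> i))"

definition wreath_product ::
    "('a, 'b) monoid_scheme \<Rightarrow> ('i, 'c) monoid_scheme \<Rightarrow> (('i \<Rightarrow> 'a) \<times> 'i) monoid" where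
  "wreath_product A Q = (let B = sum_group (carrier Q) (\<lambda>_. A) in
     \<lparr>carrier = carrier B \<times> carrier Q,
      monoid.mult = (\<lambda>(\<eta>, m) (\<theta>, n). (\<eta> \<otimes>\<^bsub>B\<^esub> translate Q m \<theta>, m \<otimes>\<^bsub>Q\<^esub> n)),
      one = (\<one>\<^bsub>B\<^esub>, \<one>\<^bsub>Q\<^esub>)\<rparr>)"

definition lamplighter_group :: "((int \<Rightarrow> int) \<times> int) monoid" where
  "lamplighter_group = wreath_product (integer_mod_group 2) integer_group"

text \<open>
  \<^const>\<open>integer_mod_group\<close> and \<^const>\<open>integer_group\<close> are written additively: the generator
  of \<open>C\<^sub>2\<close> is \<open>1\<close>, its trivial element is \<open>0\<close>, and the generator \<open>a\<close> of the infinite cyclic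
  group is \<open>1\<close>.
\<close>

definition lamplighter_gens :: "((int \<Rightarrow> int) \<times> int) set" where
  "lamplighter_gens = {(\<lambda>_. 0, 1), (\<lambda>_. 0, -1), ((\<lambda>_. 0)(0 := 1), 0)}"

text \<open>
  Words are products of elements of \<open>Y\<close> itself, without formal inverses; for a set \<open>Y\<close> that
  is closed under inverses, such as \<^const>\<open>lamplighter_gens\<close>, this is the usual word length.
  The value is only meaningful for elements of the submonoid generated by \<open>Y\<close>.
\<close>

definition word_length :: "('a, 'b) monoid_scheme \<Rightarrow> 'a set \<Rightarrow> 'a \<Rightarrow> nat" where
  "word_length G Y g =
     (LEAST n. \<exists>ws. set ws \<subseteq> Y \<and> length ws = n \<and> foldr (\<otimes>\<^bsub>G\<^esub>) ws \<one>\<^bsub>G\<^esub> = g)"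

definition conjugacy_classes :: "('a, 'b) monoid_scheme \<Rightarrow> 'a set set" where
  "conjugacy_classes G =
     orbits G (carrier G) (\<lambda>g. \<lambda>h\<in>carrier G. g \<otimes>\<^bsub>G\<^esub> h \<otimes>\<^bsub>G\<^esub> inv\<^bsub>G\<^esub> g)"

definition class_length :: "('a, 'b) monoid_scheme \<Rightarrow> 'a set \<Rightarrow> 'a set \<Rightarrow> nat" where
  "class_length G Y C = (LEAST n. \<exists>g\<in>C. word_length G Y g = n)"

definition conjugacy_growth_series :: "('a, 'b) monoid_scheme \<Rightarrow> 'a set \<Rightarrow> rat fps" where
  "conjugacy_growth_series G Y =
     Abs_fps (\<lambda>n. of_nat (card {C \<in> conjugacy_classes G. class_length G Y C = n}))"

text \<open>
  The field \<open>\<rat>(z)\<close>, embedded into the field of formal Laurent series by expansion at \<open>0\<close>.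
\<close>

definition rational_functions :: "rat fls set" where
  "rational_functions =
     {fps_to_fls (fps_of_poly p) / fps_to_fls (fps_of_poly q) | p q. q \<noteq> 0}"

definition transcendental_over_rational_functions :: "rat fps \<Rightarrow> bool" where
  "transcendental_over_rational_functions f \<longleftrightarrow>
     (let L = (ring_of_type_algebra :: rat fls ring)
      in (ring.transcendental L over rational_functions) (fps_to_fls f))"

lemma group_wreath_product:
  assumes A: "group A" and Q: "group Q"
  shows "group (wreath_product A Q)"
proof -
  interpret A: group A by fact
  interpret Q: group Q by fact
  define B where "B = sum_group (carrier Q) (\<lambda>_. A)"
  interpret B: group B unfolding B_def using A by simp
  have cB: "carrier B = {x \<in> \<Pi>\<^sub>E i\<in>carrier Q. carrier A. finite {i \<in> carrier Q. x i \<noteq> \<one>\<^bsub>A\<^esub>}}"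
    unfolding B_def using A by (simp add: carrier_sum_group)
  have mB: "x \<otimes>\<^bsub>B\<^esub> y = (\<lambda>i\<in>carrier Q. x i \<otimes>\<^bsub>A\<^esub> y i)" for x y
    by (simp add: B_def)
  have oB: "\<one>\<^bsub>B\<^esub> = (\<lambda>i\<in>carrier Q. \<one>\<^bsub>A\<^esub>)" by (simp add: B_def)
  have cl: "translate Q m t \<in> carrier B" if m: "m \<in> carrier Q" and t: "t \<in> carrier B" for m t
  proof -
    have "{i \<in> carrier Q. t (inv\<^bsub>Q\<^esub> m \<otimes>\<^bsub>Q\<^esub> i) \<noteq> \<one>\<^bsub>A\<^esub>} \<subseteq>
        (\<lambda>i. m \<otimes>\<^bsub>Q\<^esub> i) ` {i \<in> carrier Q. t i \<noteq> \<one>\<^bsub>A\<^esub>}" (is "?S \<subseteq> _")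
    proof
      fix i assume i: "i \<in> ?S"
      then have "i = m \<otimes>\<^bsub>Q\<^esub> (inv\<^bsub>Q\<^esub> m \<otimes>\<^bsub>Q\<^esub> i)"
        using m by (simp flip: Q.m_assoc)
      with i m show "i \<in> (\<lambda>i. m \<otimes>\<^bsub>Q\<^esub> i) ` {i \<in> carrier Q. t i \<noteq> \<one>\<^bsub>A\<^esub>}"
        by (metis (mono_tags, lifting) Q.inv_closed Q.m_closed image_eqI mem_Collect_eq)
    qed
    moreover have "finite {i \<in> carrier Q. t i \<noteq> \<one>\<^bsub>A\<^esub>}" using t cB by auto
    ultimately have "finite ?S" by (meson finite_imageI finite_subset)
    then show ?thesis using m t
      by (auto simp: cB translate_def PiE_iff cong: conj_cong)
  qed
  have tm: "translate Q m (s \<otimes>\<^bsub>B\<^esub> t) = translate Q m s \<otimes>\<^bsub>B\<^esub> translate Q m t"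
    if "m \<in> carrier Q" for m s t
    using that by (auto simp: translate_def mB)
  have tt: "translate Q (m \<otimes>\<^bsub>Q\<^esub> n) t = translate Q m (translate Q n t)"
    if "m \<in> carrier Q" "n \<in> carrier Q" for m n t
    using that by (auto simp: translate_def Q.inv_mult_group Q.m_assoc)
  have t1: "translate Q \<one>\<^bsub>Q\<^esub> t = t" if "t \<in> carrier B" for t
    using that by (auto simp: translate_def cB PiE_iff extensional_def)
  have to: "translate Q m \<one>\<^bsub>B\<^esub> = \<one>\<^bsub>B\<^esub>" if "m \<in> carrier Q" for m
    using that by (auto simp: translate_def oB)
  show ?thesis
    unfolding wreath_product_def Let_def B_def[symmetric]
  proof (rule groupI, goal_cases)
    case (3 x y z)
    then show ?case by (auto simp: cl tm tt B.m_assoc Q.m_assoc)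
  next
    case (5 x)
    then obtain t m where x: "x = (t, m)" "t \<in> carrier B" "m \<in> carrier Q" by auto
    then have "translate Q (inv\<^bsub>Q\<^esub> m) (inv\<^bsub>B\<^esub> t) \<otimes>\<^bsub>B\<^esub> translate Q (inv\<^bsub>Q\<^esub> m) t = \<one>\<^bsub>B\<^esub>"
      by (simp flip: tm add: to)
    with x show ?case
      by (intro bexI[of _ "(translate Q (inv\<^bsub>Q\<^esub> m) (inv\<^bsub>B\<^esub> t), inv\<^bsub>Q\<^esub> m)"]) (auto simp: cl)
  qed (auto simp: cl t1)
qed

lemma group_lamplighter_group: "group lamplighter_group"
  unfolding lamplighter_group_def by (intro group_wreath_product) simp_all

lemma lamplighter_gens_carrier: "lamplighter_gens \<subseteq> carrier lamplighter_group"
  by (auto simp: lamplighter_gens_def lamplighter_group_def wreath_product_def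
        carrier_sum_group carrier_integer_mod_group)

lemma mult_lamplighter_group:
  "(\<eta>, m) \<otimes>\<^bsub>lamplighter_group\<^esub> (\<theta>, n) = (\<lambda>i. (\<eta> i + \<theta> (i - m)) mod 2, m + n)"
  by (auto simp: lamplighter_group_def wreath_product_def translate_def)

lemma lamplighter_gens_generate:
  assumes "g \<in> carrier lamplighter_group"
  shows "\<exists>ws. set ws \<subseteq> lamplighter_gens \<and>
           foldr (\<otimes>\<^bsub>lamplighter_group\<^esub>) ws \<one>\<^bsub>lamplighter_group\<^esub> = g"
proof -
  let ?L = lamplighter_group
  interpret group ?L by (rule group_lamplighter_group)
  define R where "R g \<longleftrightarrow> (\<exists>ws. set ws \<subseteq> lamplighter_gens \<and> foldr (\<otimes>\<^bsub>?L\<^esub>) ws \<one>\<^bsub>?L\<^esub> = g)" for g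
  have app: "foldr (\<otimes>\<^bsub>?L\<^esub>) (us @ vs) \<one>\<^bsub>?L\<^esub> =
      foldr (\<otimes>\<^bsub>?L\<^esub>) us \<one>\<^bsub>?L\<^esub> \<otimes>\<^bsub>?L\<^esub> foldr (\<otimes>\<^bsub>?L\<^esub>) vs \<one>\<^bsub>?L\<^esub>"
    if "set us \<subseteq> carrier ?L" "set vs \<subseteq> carrier ?L" for us vs
    using that by (induction us) (auto simp: m_assoc)
  have R_mult: "R (g \<otimes>\<^bsub>?L\<^esub> h)" if gh: "R g" "R h" for g h
  proof -
    obtain us vs where "set us \<subseteq> lamplighter_gens" "foldr (\<otimes>\<^bsub>?L\<^esub>) us \<one>\<^bsub>?L\<^esub> = g"
        "set vs \<subseteq> lamplighter_gens" "foldr (\<otimes>\<^bsub>?L\<^esub>) vs \<one>\<^bsub>?L\<^esub> = h"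
      using gh unfolding R_def by blast
    moreover from this have "foldr (\<otimes>\<^bsub>?L\<^esub>) (us @ vs) \<one>\<^bsub>?L\<^esub> = g \<otimes>\<^bsub>?L\<^esub> h"
      using app[of us vs] lamplighter_gens_carrier by simp
    ultimately show ?thesis
      unfolding R_def by (intro exI[of _ "us @ vs"]) auto
  qed
  have R_gen: "R g" if "g \<in> lamplighter_gens" for g
    unfolding R_def using that lamplighter_gens_carrier by (intro exI[of _ "[g]"]) auto
  have "R \<one>\<^bsub>?L\<^esub>" unfolding R_def by (intro exI[of _ "[]"]) auto
  then have R1: "R (\<lambda>_. 0, 0)"
    by (simp add: lamplighter_group_def wreath_product_def restrict_def)
  have Rz: "R (\<lambda>_. 0, k)" for k
  proof (induction k rule: int_induct[where k = 0])
    case base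
    then show ?case by (rule R1)
  next
    case (step1 i)
    have "R ((\<lambda>_. 0, i) \<otimes>\<^bsub>?L\<^esub> (\<lambda>_. 0, 1))"
      by (rule R_mult[OF step1(2) R_gen]) (simp add: lamplighter_gens_def)
    then show ?case by (simp add: mult_lamplighter_group)
  next
    case (step2 i)
    have "R ((\<lambda>_. 0, i) \<otimes>\<^bsub>?L\<^esub> (\<lambda>_. 0, -1))"
      by (rule R_mult[OF step2(2) R_gen]) (simp add: lamplighter_gens_def)
    then show ?case by (simp add: mult_lamplighter_group)
  qed
  have Ry: "R ((\<lambda>_. 0)(k := 1), 0)" for k
  proof -
    have "R ((\<lambda>_. 0, k) \<otimes>\<^bsub>?L\<^esub> (((\<lambda>_. 0)(0 := 1), 0) \<otimes>\<^bsub>?L\<^esub> (\<lambda>_. 0, -k)))"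
      by (rule R_mult[OF Rz R_mult[OF R_gen Rz]]) (simp add: lamplighter_gens_def)
    also have "(\<lambda>_. 0, k) \<otimes>\<^bsub>?L\<^esub> (((\<lambda>_. 0)(0 := 1), 0) \<otimes>\<^bsub>?L\<^esub> (\<lambda>_. 0, -k)) =
        ((\<lambda>_. 0)(k := 1), 0)"
      by (auto simp: mult_lamplighter_group fun_eq_iff)
    finally show ?thesis .
  qed
  have RS: "R (\<lambda>i. if i \<in> S then 1 else 0, 0)" if "finite S" for S
    using that
  proof (induction S)
    case empty
    then show ?case using R1 by simp
  next
    case (insert k S)
    have "R (((\<lambda>_. 0)(k := 1), 0) \<otimes>\<^bsub>?L\<^esub> (\<lambda>i. if i \<in> S then 1 else 0, 0))"
      using insert.IH Ry R_mult by blast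
    also have "((\<lambda>_. 0)(k := 1), 0) \<otimes>\<^bsub>?L\<^esub> (\<lambda>i. if i \<in> S then 1 else 0, 0) =
        (\<lambda>i. if i \<in> insert k S then 1 else 0, 0)"
      using insert.hyps by (auto simp: mult_lamplighter_group fun_eq_iff)
    finally show ?case .
  qed
  obtain \<eta> m where g: "g = (\<eta>, m)" by (cases g)
  have \<eta>: "\<eta> i \<in> {0..<2}" "finite {i. \<eta> i \<noteq> 0}" for i
    using assms unfolding g
    by (auto simp: lamplighter_group_def wreath_product_def carrier_sum_group
          carrier_integer_mod_group PiE_iff)
  have "R ((\<lambda>i. if i \<in> {i. \<eta> i \<noteq> 0} then 1 else 0, 0) \<otimes>\<^bsub>?L\<^esub> (\<lambda>_. 0, m))"
    by (rule R_mult[OF RS[OF \<eta>(2)] Rz])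
  also have "(\<lambda>i. if i \<in> {i. \<eta> i \<noteq> 0} then 1 else 0, 0) \<otimes>\<^bsub>?L\<^esub> (\<lambda>_. 0, m) = g"
  proof -
    have "\<eta> i = 0 \<or> \<eta> i = 1" for i using \<eta>(1)[of i] by auto
    then show ?thesis unfolding g by (auto simp: mult_lamplighter_group fun_eq_iff)
  qed
  finally show ?thesis unfolding R_def .
qed

text \<open>Hence \<^const>\<open>card\<close> is not applied to an infinite set in the growth series.\<close>

lemma finite_classes_of_length:
  "finite {C \<in> conjugacy_classes lamplighter_group.
             class_length lamplighter_group lamplighter_gens C = n}"
proof -
  let ?L = lamplighter_group and ?Y = lamplighter_gens
  interpret group ?L by (rule group_lamplighter_group)
  let ?\<phi> = "\<lambda>g. \<lambda>h\<in>carrier ?L. g \<otimes>\<^bsub>?L\<^esub> h \<otimes>\<^bsub>?L\<^esub> inv\<^bsub>?L\<^esub> g"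
  interpret C: group_action ?L "carrier ?L" ?\<phi> by (rule action_by_conjugation)
  define W where "W = {ws. set ws \<subseteq> ?Y \<and> length ws = n}"
  let ?ev = "\<lambda>ws. foldr (\<otimes>\<^bsub>?L\<^esub>) ws \<one>\<^bsub>?L\<^esub>"
  have "finite W"
    unfolding W_def by (rule finite_lists_length_eq) (simp add: lamplighter_gens_def)
  moreover have "{C \<in> conjugacy_classes ?L. class_length ?L ?Y C = n}
      \<subseteq> (\<lambda>ws. orbit ?L ?\<phi> (?ev ws)) ` W"
  proof (rule subsetI, elim CollectE conjE)
    fix C assume C: "C \<in> conjugacy_classes ?L" and n: "class_length ?L ?Y C = n"
    from C obtain x where x: "C = orbit ?L ?\<phi> x" "x \<in> carrier ?L"
      unfolding conjugacy_classes_def orbits_def by blast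
    have "x \<in> C" using x by (auto intro: C.orbit_refl)
    then have "\<exists>k. \<exists>g\<in>C. word_length ?L ?Y g = k" by blast
    from LeastI_ex[OF this] n obtain g where g: "g \<in> C" "word_length ?L ?Y g = n"
      unfolding class_length_def by blast
    have gL: "g \<in> carrier ?L" using g x by (auto simp: orbit_def)
    have "\<exists>k ws. set ws \<subseteq> ?Y \<and> length ws = k \<and> ?ev ws = g"
      using lamplighter_gens_generate[OF gL] by blast
    from LeastI_ex[OF this] g obtain ws where ws: "ws \<in> W" "?ev ws = g"
      unfolding word_length_def W_def by blast
    have "orbit ?L ?\<phi> g \<in> orbits ?L (carrier ?L) ?\<phi>" "g \<in> orbit ?L ?\<phi> g"
      using gL unfolding orbits_def by (blast intro: C.orbit_refl)+
    then have "orbit ?L ?\<phi> g = C"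
      using C g(1) C.disjoint_union unfolding conjugacy_classes_def by blast
    with ws show "C \<in> (\<lambda>ws. orbit ?L ?\<phi> (?ev ws)) ` W" by blast
  qed
  ultimately show ?thesis by (meson finite_imageI finite_subset)
qed

lemma subfield_rational_functions: "subfield rational_functions ring_of_type_algebra"
proof -
  let ?L = "ring_of_type_algebra :: rat fls ring"
  interpret field ?L by (rule field_from_type_algebra)
  let ?e = "\<lambda>p :: rat poly. fps_to_fls (fps_of_poly p)"
  have [simp]: "?e p = 0 \<longleftrightarrow> p = 0" for p
    by simp
  have memI: "?e p / ?e q \<in> rational_functions" if "q \<noteq> 0" for p q
    using that unfolding rational_functions_def by blast
  have ops: "a \<otimes>\<^bsub>?L\<^esub> b = a * b" "a \<oplus>\<^bsub>?L\<^esub> b = a + b" "\<one>\<^bsub>?L\<^esub> = 1" "\<zero>\<^bsub>?L\<^esub> = 0"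
      "carrier ?L = UNIV" for a b
    by (simp_all add: ring_of_type_algebra_def)
  have neg: "\<ominus>\<^bsub>?L\<^esub> a = - a" for a
    by (intro minus_equality) (auto simp: ops)
  have inv: "inv\<^bsub>?L\<^esub> a = inverse a" if "a \<noteq> 0" for a
    using that by (intro comm_inv_char) (auto simp: ops)
  show ?thesis
  proof (rule subfieldI')
    show "subring rational_functions ?L"
    proof (rule subringI)
      show "\<one>\<^bsub>?L\<^esub> \<in> rational_functions"
        using memI[of 1 1] by (simp add: ops)
    next
      fix h assume "h \<in> rational_functions"
      then obtain p q where "h = ?e p / ?e q" "q \<noteq> 0" unfolding rational_functions_def by blast
      then show "\<ominus>\<^bsub>?L\<^esub> h \<in> rational_functions"
        using memI[of q "-p"] by (simp add: neg fps_of_poly_uminus)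
    next
      fix h k assume "h \<in> rational_functions" "k \<in> rational_functions"
      then obtain p q r s where *: "h = ?e p / ?e q" "q \<noteq> 0" "k = ?e r / ?e s" "s \<noteq> 0"
        unfolding rational_functions_def by blast
      show "h \<otimes>\<^bsub>?L\<^esub> k \<in> rational_functions"
        using memI[of "q * s" "p * r"] * by (simp add: ops fps_of_poly_mult fls_times_fps_to_fls)
      have "h + k = ?e (p * s + r * q) / ?e (q * s)"
        using * by (simp add: fps_of_poly_mult fps_of_poly_add fls_times_fps_to_fls
              add_frac_eq)
      then show "h \<oplus>\<^bsub>?L\<^esub> k \<in> rational_functions"
        using memI[of "q * s" "p * s + r * q"] * by (simp add: ops)
    qed (auto simp: ops)
  next
    fix k assume "k \<in> rational_functions - {\<zero>\<^bsub>?L\<^esub>}"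
    then obtain p q where *: "k = ?e p / ?e q" "q \<noteq> 0" "k \<noteq> 0"
      unfolding rational_functions_def by (auto simp: ops)
    then have "p \<noteq> 0" by auto
    then show "inv\<^bsub>?L\<^esub> k \<in> rational_functions"
      using memI[of p q] * by (simp add: inv)
  qed
qed

end

theory Submission
  imports Defs "HOL-Analysis.FPS_Convergence"
begin

text \<open>
  Write an element of the group as a finite set of lit lamps with a cursor position \<open>m\<close>. For
  \<open>m \<noteq> 0\<close> a conjugacy class is determined by the parities of the numbers of lit lamps in the residue
  classes modulo \<open>m\<close>, up to rotation: it is a binary necklace with \<open>\<bar>m\<bar>\<close> beads
  (\<open>lamp_class_eq_iff_residue_parity\<close>). A shortest representative costs one letter for each step of the
  cursor and one for each odd bead. In the growth series, evaluated at a real \<open>x > 0\<close>, an even bead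
  therefore has weight \<open>x\<close> and an odd bead has weight \<open>x\<^sup>2\<close>, and all binary words of length \<open>n\<close>
  together have weight \<open>t ^ n\<close> with \<open>t = x + x\<^sup>2\<close>.

  A necklace with \<open>n\<close> beads consists of at most \<open>n\<close> words, and of exactly \<open>n\<close> words unless it is
  periodic. Up to the exponentially small contribution of periodic words, the necklaces with \<open>n\<close>
  beads thus weigh \<open>t ^ n / n\<close> for each sign of the cursor, and the sum over \<open>n\<close> is
  \<open>- ln (1 - t)\<close>. The classes with cursor \<open>0\<close> only contribute a bounded amount. Consequently the
  growth series \<open>F\<close> satisfies, with a constant \<open>K\<close>,
  \<open>- ln (1 - t) \<le> F x \<le> K - 2 * ln (1 - t)\<close> on the left of the point \<open>\<rho>\<close> where \<open>t = 1\<close>, the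
  reciprocal of the golden ratio (\<open>sum_short_classes_ge\<close>, \<open>sum_short_classes_le\<close>).

  So \<open>F\<close> tends to infinity at \<open>\<rho>\<close>, but more slowly than every power of \<open>1 / (\<rho> - x)\<close>. No algebraic
  function behaves like this (\<open>transcendental_if_logarithmic_blowup\<close>).
\<close>

section \<open>Slow growth at a singularity and transcendence\<close>

text \<open>
  A common power of \<open>x - \<rho>\<close> can be divided out of the coefficients, so some coefficient does not
  vanish at \<open>\<rho>\<close>. Let \<open>j\<close> be the largest index of such a coefficient and divide the relation by
  \<open>F x ^ j\<close>: the terms of smaller degree tend to \<open>0\<close> because \<open>F\<close> tends to infinity, those of
  larger degree because their coefficients contain a factor \<open>x - \<rho>\<close>, which beats every power of \<open>F\<close>,
  and the term of degree \<open>j\<close> keeps a nonzero limit.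
\<close>

lemma no_algebraic_relation_at_logarithmic_blowup:
  fixes F :: "real \<Rightarrow> real" and q :: "nat \<Rightarrow> real poly"
  assumes inf: "filterlim F at_top (at_left \<rho>)"
    and slow: "\<And>i. ((\<lambda>x. (\<rho> - x) * F x ^ i) \<longlongrightarrow> 0) (at_left \<rho>)"
    and rel: "eventually (\<lambda>x. (\<Sum>i\<le>d. poly (q i) x * F x ^ i) = 0) (at_left \<rho>)"
    and i: "i \<le> d"
  shows "q i = 0"
proof (rule ccontr)
  assume "q i \<noteq> 0"
  \<comment> \<open>The largest power of \<open>x - \<rho>\<close> that divides all coefficients.\<close>
  define m where "m = Min ((\<lambda>i. Polynomial.order \<rho> (q i)) ` {i. i \<le> d \<and> q i \<noteq> 0})"
  have fin: "finite ((\<lambda>i. Polynomial.order \<rho> (q i)) ` {i. i \<le> d \<and> q i \<noteq> 0})" by simp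
  have "\<exists>r. q i = [:-\<rho>, 1:] ^ m * r" if "i \<le> d" for i
  proof (cases "q i = 0")
    case False
    then have "m \<le> Polynomial.order \<rho> (q i)"
      unfolding m_def using that fin by (intro Min_le) auto
    then have "[:-\<rho>, 1:] ^ m dvd q i" by (simp add: order_divides)
    then show ?thesis by (auto elim: dvdE)
  qed (intro exI[of _ 0], simp)
  then obtain r where r: "q i = [:-\<rho>, 1:] ^ m * r i" if "i \<le> d" for i by metis
  have "m \<in> (\<lambda>i. Polynomial.order \<rho> (q i)) ` {i. i \<le> d \<and> q i \<noteq> 0}"
    unfolding m_def using i \<open>q i \<noteq> 0\<close> fin by (intro Min_in) auto
  then obtain j0 where j0: "j0 \<le> d" "q j0 \<noteq> 0" "m = Polynomial.order \<rho> (q j0)" by auto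
  have "poly (r j0) \<rho> \<noteq> 0"
  proof
    assume "poly (r j0) \<rho> = 0"
    then obtain s where "r j0 = [:-\<rho>, 1:] * s" by (auto simp: poly_eq_0_iff_dvd elim: dvdE)
    then have "[:-\<rho>, 1:] ^ Suc m dvd q j0" 
      unfolding r[OF j0(1)] power_Suc2 by (simp only: mult_dvd_mono dvd_refl dvd_triv_left)
    with j0 show False by (metis not_less_eq_eq order_divides order_refl)
  qed
  define J where "J = {i. i \<le> d \<and> poly (r i) \<rho> \<noteq> 0}"
  define j where "j = Max J"
  have J: "finite J" "J \<noteq> {}" using j0 \<open>poly (r j0) \<rho> \<noteq> 0\<close> by (auto simp: J_def)
  then have j: "j \<in> J" and jmax: "\<And>i. i \<in> J \<Longrightarrow> i \<le> j" by (auto simp: j_def)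
  let ?T = "\<lambda>i x. poly (r i) x * F x ^ i / F x ^ j"
  have pos: "eventually (\<lambda>x. F x > 0) (at_left \<rho>)"
    using inf by (simp add: filterlim_at_top_dense)
  have below: "eventually (\<lambda>x. x < \<rho>) (at_left \<rho>)"
    by (simp add: eventually_at_filter)
  have cont: "((\<lambda>x. poly p x) \<longlongrightarrow> poly p \<rho>) (at_left \<rho>)" for p :: "real poly"
    by (intro tendsto_poly tendsto_ident_at)
  have lim: "(?T i \<longlongrightarrow> (if i = j then poly (r j) \<rho> else 0)) (at_left \<rho>)" if "i \<le> d" for i
  proof -
    consider "i < j" | "i = j" | "i > j" by linarith
    then show ?thesis
    proof cases
      case 1
      have "filterlim (\<lambda>x. F x ^ (j - i)) at_infinity (at_left \<rho>)"
        using 1 inf by (intro filterlim_at_top_imp_at_infinity filterlim_pow_at_top) auto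
      then have "((\<lambda>x. poly (r i) x / F x ^ (j - i)) \<longlongrightarrow> 0) (at_left \<rho>)"
        by (rule tendsto_divide_0[OF cont])
      moreover have "eventually (\<lambda>x. poly (r i) x / F x ^ (j - i) = ?T i x) (at_left \<rho>)"
        using pos
      proof eventually_elim
        case (elim x)
        have "F x ^ j = F x ^ (j - i) * F x ^ i" using 1 by (simp flip: power_add)
        with elim show ?case by simp
      qed
      ultimately show ?thesis using 1 by (simp cong: tendsto_cong)
    next
      case 2
      have "eventually (\<lambda>x. poly (r i) x = ?T i x) (at_left \<rho>)"
        using pos by eventually_elim (simp add: 2)
      from Lim_transform_eventually[OF cont this] show ?thesis using 2 by (simp only: if_True refl)
    next
      case 3
      then have "poly (r i) \<rho> = 0" using jmax[of i] that by (force simp: J_def)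
      then obtain s where s: "r i = [:-\<rho>, 1:] * s" by (auto simp: poly_eq_0_iff_dvd elim: dvdE)
      have "((\<lambda>x. - poly s x * ((\<rho> - x) * F x ^ (i - j))) \<longlongrightarrow> - poly s \<rho> * 0) (at_left \<rho>)"
        by (intro tendsto_mult tendsto_minus cont slow)
      moreover have "eventually (\<lambda>x. - poly s x * ((\<rho> - x) * F x ^ (i - j)) = ?T i x) (at_left \<rho>)"
        using pos
      proof eventually_elim
        case (elim x)
        have "F x ^ i = F x ^ (i - j) * F x ^ j" using 3 by (simp flip: power_add)
        moreover have "poly (r i) x = (x - \<rho>) * poly s x" by (simp add: s algebra_simps)
        ultimately have "poly (r i) x * F x ^ i / F x ^ j = (x - \<rho>) * poly s x * F x ^ (i - j)"
          using elim by simp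
        then show ?case by (simp add: algebra_simps)
      qed
      ultimately have "(?T i \<longlongrightarrow> - poly s \<rho> * 0) (at_left \<rho>)"
        by (rule Lim_transform_eventually)
      then show ?thesis using 3 by simp
    qed
  qed
  have sum_lim: "((\<lambda>x. \<Sum>i\<le>d. ?T i x) \<longlongrightarrow> (\<Sum>i\<le>d. if i = j then poly (r j) \<rho> else 0)) (at_left \<rho>)"
    by (intro tendsto_sum lim) auto
  have sum_eq: "(\<Sum>i\<le>d. if i = j then poly (r j) \<rho> else 0) = poly (r j) \<rho>"
    using j by (simp add: J_def)
  have "eventually (\<lambda>x. (\<Sum>i\<le>d. ?T i x) = 0) (at_left \<rho>)"
    using pos rel below
  proof eventually_elim
    case (elim x)
    have "0 = (\<Sum>i\<le>d. (x - \<rho>) ^ m * (poly (r i) x * F x ^ i))"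
      unfolding elim(2)[symmetric] by (rule sum.cong) (auto simp: r algebra_simps)
    also have "\<dots> = (x - \<rho>) ^ m * (\<Sum>i\<le>d. poly (r i) x * F x ^ i)"
      by (simp add: sum_distrib_left)
    finally have "(\<Sum>i\<le>d. poly (r i) x * F x ^ i) = 0" using elim by auto
    then show ?case by (simp flip: sum_divide_distrib)
  qed
  from Lim_transform_eventually[OF sum_lim this]
  have "((\<lambda>x. 0 :: real) \<longlongrightarrow> poly (r j) \<rho>) (at_left \<rho>)"
    by (simp only: sum_eq)
  then have "poly (r j) \<rho> = 0" by (simp add: tendsto_const_iff)
  with j show False by (simp add: J_def)
qed

definition real_fps :: "rat fps \<Rightarrow> real fps" where
  "real_fps f = Abs_fps (\<lambda>n. of_rat (f $ n))"

lemma real_fps_0 [simp]: "real_fps 0 = 0"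
  by (simp add: real_fps_def fps_eq_iff)

lemma real_fps_1 [simp]: "real_fps 1 = 1"
  by (simp add: real_fps_def fps_eq_iff)

lemma real_fps_add: "real_fps (f + g) = real_fps f + real_fps g"
  by (simp add: real_fps_def fps_eq_iff of_rat_add)

lemma real_fps_mult: "real_fps (f * g) = real_fps f * real_fps g"
  by (simp add: real_fps_def fps_eq_iff fps_mult_nth of_rat_sum of_rat_mult)

lemma real_fps_power: "real_fps (f ^ n) = real_fps f ^ n"
  by (induction n) (simp_all add: real_fps_mult)

lemma real_fps_sum: "real_fps (sum f A) = (\<Sum>i\<in>A. real_fps (f i))"
  by (induction A rule: infinite_finite_induct) (simp_all add: real_fps_add)

lemma real_fps_of_poly: "real_fps (fps_of_poly p) = fps_of_poly (map_poly of_rat p)"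
  by (simp add: real_fps_def fps_eq_iff coeff_map_poly)

text \<open>
  An element of \<^const>\<open>univ_poly\<close> is the list of its coefficients, the leading one first. After
  multiplication by a common denominator \<open>c\<close>, its value at \<open>f\<close> is a polynomial in \<open>f\<close> with
  coefficients in the polynomial ring, and the leading coefficient stays nonzero.
\<close>

lemma clear_denominators:
  fixes f :: "rat fps" and p :: "rat fls list"
  assumes "set p \<subseteq> rational_functions"
  shows "\<exists>c q. c \<noteq> 0 \<and>
           fps_to_fls (fps_of_poly c) * ring.eval ring_of_type_algebra p (fps_to_fls f) =
             fps_to_fls (\<Sum>i<length p. fps_of_poly (q i) * f ^ i) \<and>
           (p \<noteq> [] \<longrightarrow> hd p \<noteq> 0 \<longrightarrow> q (length p - 1) \<noteq> 0)"
  using assms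
proof (induction p)
  interpret field "ring_of_type_algebra :: rat fls ring" by (rule field_from_type_algebra)
  case Nil
  have "eval [] (fps_to_fls f) = 0"
    by simp (simp add: ring_of_type_algebra_def)
  then show ?case by (intro exI[of _ 1]) simp
next
  let ?L = "ring_of_type_algebra :: rat fls ring"
  let ?e = "\<lambda>p :: rat poly. fps_to_fls (fps_of_poly p)"
  interpret field ?L by (rule field_from_type_algebra)
  case (Cons a p)
  from Cons obtain c q where IH: "c \<noteq> 0" "?e c * eval p (fps_to_fls f) =
             fps_to_fls (\<Sum>i<length p. fps_of_poly (q i) * f ^ i)" by auto
  from Cons obtain r s where a: "a = ?e r / ?e s" "s \<noteq> 0"
    unfolding rational_functions_def by auto
  define q' where "q' = (\<lambda>i. if i = length p then c * r else s * q i)"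
  have pow: "x [^]\<^bsub>?L\<^esub> n = x ^ n" for x and n :: nat
    by (induction n) (simp_all add: ring_of_type_algebra_def mult.commute)
  have "eval (a # p) (fps_to_fls f) = a * fps_to_fls f ^ length p + eval p (fps_to_fls f)"
    by (simp add: pow) (simp add: ring_of_type_algebra_def)
  then have "?e (c * s) * eval (a # p) (fps_to_fls f) =
      ?e c * (?e s * a) * fps_to_fls f ^ length p + ?e s * (?e c * eval p (fps_to_fls f))"
    by (simp add: fps_of_poly_mult fls_times_fps_to_fls algebra_simps)
  also have "?e s * a = ?e r" using a by simp
  also have "?e c * ?e r * fps_to_fls f ^ length p + ?e s * (?e c * eval p (fps_to_fls f)) =
      fps_to_fls (fps_of_poly (c * r) * f ^ length p +
        fps_of_poly s * (\<Sum>i<length p. fps_of_poly (q i) * f ^ i))"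
    unfolding IH(2) by (simp add: fps_of_poly_mult fls_times_fps_to_fls fps_to_fls_power)
  also have "\<dots> = fps_to_fls (\<Sum>i<length (a # p). fps_of_poly (q' i) * f ^ i)"
    by (simp add: q'_def sum_distrib_left fps_of_poly_mult mult.assoc add.commute)
  finally have "?e (c * s) * eval (a # p) (fps_to_fls f) =
      fps_to_fls (\<Sum>i<length (a # p). fps_of_poly (q' i) * f ^ i)" .
  moreover have "a \<noteq> 0 \<Longrightarrow> q' (length p) \<noteq> 0"
    using a IH by (auto simp: q'_def)
  ultimately show ?case using IH(1) a(2)
    by (intro exI[of _ "c * s"] exI[of _ q']) auto
qed

text \<open>
  An algebraic function that tends to infinity at a finite point does so at least as fast as some
  positive power of the reciprocal distance. Hence growth that is slower than all such powers
  excludes an algebraic relation; formally, a relation between power series is evaluated at real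
  points close to \<open>\<rho>\<close>.
\<close>

theorem transcendental_if_logarithmic_blowup:
  fixes f :: "rat fps" and \<rho> :: real
  assumes \<rho>: "0 < \<rho>" and conv: "ereal \<rho> \<le> fps_conv_radius (real_fps f)"
    and inf: "filterlim (eval_fps (real_fps f)) at_top (at_left \<rho>)"
    and slow: "\<And>i. ((\<lambda>x. (\<rho> - x) * eval_fps (real_fps f) x ^ i) \<longlongrightarrow> 0) (at_left \<rho>)"
  shows "transcendental_over_rational_functions f"
proof (rule ccontr)
  let ?L = "ring_of_type_algebra :: rat fls ring"
  interpret field ?L by (rule field_from_type_algebra)
  assume "\<not> transcendental_over_rational_functions f"
  then have alg: "(algebraic over rational_functions) (fps_to_fls f)"
    unfolding transcendental_over_rational_functions_def Let_def over_def .
  have sub: "subring rational_functions ?L"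
    using subfield_rational_functions by (rule subfieldE(1))
  obtain p where p: "p \<in> carrier (rational_functions [X]\<^bsub>?L\<^esub>)" "p \<noteq> []"
      "eval p (fps_to_fls f) = \<zero>\<^bsub>?L\<^esub>"
    by (rule algebraicE[OF sub _ alg]) (auto simp: ring_of_type_algebra_def)
  then have pol: "polynomial\<^bsub>?L\<^esub> rational_functions p" by (simp add: univ_poly_carrier)
  then have "set p \<subseteq> rational_functions" by (rule polynomial_incl)
  from clear_denominators[OF this, of f] obtain c q where q:
      "fps_to_fls (fps_of_poly c) * eval p (fps_to_fls f) =
        fps_to_fls (\<Sum>i<length p. fps_of_poly (q i) * f ^ i)"
      "hd p \<noteq> 0 \<Longrightarrow> q (length p - 1) \<noteq> 0"
    using p(2) by auto
  have "hd p \<noteq> 0" using pol p(2) unfolding polynomial_def by (simp add: ring_of_type_algebra_def)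
  then have "q (length p - 1) \<noteq> 0" by (rule q(2))
  have "eval p (fps_to_fls f) = 0" using p(3) by (simp add: ring_of_type_algebra_def)
  with q(1) have "(\<Sum>i<length p. fps_of_poly (q i) * f ^ i) = 0"
    by (metis fps_to_fls_eq_0_iff mult_zero_right)
  then have "real_fps (\<Sum>i<length p. fps_of_poly (q i) * f ^ i) = 0"
    by simp
  then have rel: "(\<Sum>i\<le>length p - 1. fps_of_poly (map_poly of_rat (q i)) * real_fps f ^ i) = 0"
    using p(2) by (simp add: real_fps_sum real_fps_mult real_fps_power real_fps_of_poly
        lessThan_Suc_atMost[symmetric])
  define d where "d = length p - 1"
  have ev: "eval_fps (\<Sum>i\<le>d. fps_of_poly (q i) * real_fps f ^ i) x =
      (\<Sum>i\<le>d. poly (q i) x * eval_fps (real_fps f) x ^ i) \<and>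
      ereal (norm x) < fps_conv_radius (\<Sum>i\<le>d. fps_of_poly (q i) * real_fps f ^ i)"
    if "norm x < \<rho>" for x d and q :: "nat \<Rightarrow> real poly"
  proof -
    have x: "ereal (norm x) < fps_conv_radius (real_fps f)"
      using that conv by (intro less_le_trans[OF _ conv]) simp
    have x': "ereal (norm x) < fps_conv_radius (real_fps f ^ i)" for i
      using x fps_conv_radius_power[of "real_fps f" i] by (meson less_le_trans)
    have 1: "ereal (norm x) < fps_conv_radius (fps_of_poly (q i) * real_fps f ^ i)" for i
      using x' fps_conv_radius_mult[of "fps_of_poly (q i)" "real_fps f ^ i"]
      by (intro less_le_trans[OF _ fps_conv_radius_mult]) simp
    have 2: "eval_fps (fps_of_poly (q i) * real_fps f ^ i) x = poly (q i) x * eval_fps (real_fps f) x ^ i" for i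
      using x x' by (subst eval_fps_mult) (auto simp: eval_fps_power)
    show ?thesis
    proof (induction d)
      case (Suc d)
      then show ?case using 1[of "Suc d"]
        by (auto simp: eval_fps_add 2 simp del: power_Suc intro!: less_le_trans[OF _ fps_conv_radius_add])
    qed (use 1 2 in auto)
  qed
  have "eventually (\<lambda>x. norm x < \<rho>) (at_left \<rho>)"
    using \<rho> eventually_at_left_real[OF \<rho>] by (auto elim: eventually_mono)
  then have "eventually (\<lambda>x. (\<Sum>i\<le>d. poly (map_poly of_rat (q i)) x * eval_fps (real_fps f) x ^ i) = 0) (at_left \<rho>)"
  proof eventually_elim
    case (elim x)
    show ?case
      using ev[OF elim, of "\<lambda>i. map_poly of_rat (q i)" d] rel by (simp add: d_def)
  qed
  from no_algebraic_relation_at_logarithmic_blowup[OF inf slow this, of d]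
  have "map_poly of_rat (q d) = (0 :: real poly)" by simp
  then have "q d = 0" by (simp add: map_poly_eq_0_iff)
  with \<open>q (length p - 1) \<noteq> 0\<close> show False by (simp add: d_def)
qed

section \<open>Conjugacy classes as binary necklaces\<close>

lemma mem_translate_iff: "i \<in> (+) m ` T \<longleftrightarrow> i - m \<in> T" for i m :: int
  by (auto simp: image_iff intro: bexI[of _ "i - m"])

text \<open>
  An element of the group is a finite set of lit lamps together with a position of the cursor. In
  this form the group operation is symmetric difference after a translation.
\<close>

definition lamp :: "int set \<Rightarrow> int \<Rightarrow> (int \<Rightarrow> int) \<times> int" where
  "lamp S m = (\<lambda>i. if i \<in> S then 1 else 0, m)"

lemma lamp_eq_iff [simp]: "lamp S m = lamp T n \<longleftrightarrow> S = T \<and> m = n"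
  by (auto simp: lamp_def fun_eq_iff split: if_splits)

lemma carrier_lamplighter_group: "carrier lamplighter_group = {lamp S m | S m. finite S}"
proof (intro equalityI subsetI)
  fix g assume g: "g \<in> carrier lamplighter_group"
  obtain \<eta> m where \<eta>m: "g = (\<eta>, m)" by (cases g)
  have \<eta>: "\<eta> i \<in> {0..<2}" "finite {i. \<eta> i \<noteq> 0}" for i
    using g unfolding \<eta>m
    by (auto simp: lamplighter_group_def wreath_product_def carrier_sum_group
          carrier_integer_mod_group PiE_iff)
  have "\<eta> i = 0 \<or> \<eta> i = 1" for i using \<eta>(1)[of i] by auto
  then have "g = lamp {i. \<eta> i \<noteq> 0} m" by (auto simp: lamp_def \<eta>m fun_eq_iff)
  then show "g \<in> {lamp S m | S m. finite S}" using \<eta>(2) by blast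
next
  fix g assume "g \<in> {lamp S m | S m. finite S}"
  then obtain S m where "g = lamp S m" "finite S" by blast
  moreover have "{i. (if i \<in> S then 1 else 0 :: int) \<noteq> 0} = S" by simp
  ultimately show "g \<in> carrier lamplighter_group"
    by (simp add: lamp_def lamplighter_group_def wreath_product_def carrier_sum_group
          carrier_integer_mod_group PiE_iff)
qed

lemma lamp_in_carrier [simp]: "finite S \<Longrightarrow> lamp S m \<in> carrier lamplighter_group"
  by (auto simp: carrier_lamplighter_group)

lemma mult_lamp: "lamp S m \<otimes>\<^bsub>lamplighter_group\<^esub> lamp T n = lamp (sym_diff S ((+) m ` T)) (m + n)"
  unfolding lamp_def mult_lamplighter_group
  by (intro arg_cong2[of _ _ _ _ Pair] ext) (simp_all add: mem_translate_iff)

lemma one_lamp: "\<one>\<^bsub>lamplighter_group\<^esub> = lamp {} 0"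
  by (simp add: lamp_def lamplighter_group_def wreath_product_def restrict_def)

definition lamp_class :: "int set \<Rightarrow> int \<Rightarrow> ((int \<Rightarrow> int) \<times> int) set" where
  "lamp_class S m = orbit lamplighter_group
     (\<lambda>g. \<lambda>h\<in>carrier lamplighter_group. g \<otimes>\<^bsub>lamplighter_group\<^esub> h \<otimes>\<^bsub>lamplighter_group\<^esub> inv\<^bsub>lamplighter_group\<^esub> g)
     (lamp S m)"

lemma conjugacy_classes_lamp:
  "conjugacy_classes lamplighter_group = {lamp_class S m | S m. finite S}"
  unfolding conjugacy_classes_def orbits_def lamp_class_def carrier_lamplighter_group by blast

text \<open>
  Conjugation by a lamp configuration \<open>\<theta>\<close> changes the lamps of an element with cursor \<open>m\<close> by
  \<open>\<theta> - m \<cdot> \<theta>\<close>, which is \<open>\<theta> + m \<cdot> \<theta>\<close> in characteristic two: a coboundary of the action of the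
  cursor.
\<close>

definition coboundary :: "int \<Rightarrow> int set \<Rightarrow> int set" where
  "coboundary m \<theta> = sym_diff \<theta> ((+) m ` \<theta>)"

lemma mem_lamp_class_iff:
  assumes S: "finite S"
  shows "g \<in> lamp_class S m \<longleftrightarrow>
    (\<exists>k \<theta>. finite \<theta> \<and> g = lamp (sym_diff ((+) k ` S) (coboundary m \<theta>)) m)"
proof -
  let ?L = lamplighter_group
  interpret group ?L by (rule group_lamplighter_group)
  have "g \<in> lamp_class S m \<longleftrightarrow> (\<exists>p\<in>carrier ?L. g = p \<otimes>\<^bsub>?L\<^esub> lamp S m \<otimes>\<^bsub>?L\<^esub> inv\<^bsub>?L\<^esub> p)"
    using S by (auto simp: lamp_class_def orbit_def)
  also have "\<dots> \<longleftrightarrow> (\<exists>p\<in>carrier ?L. g \<in> carrier ?L \<and> g \<otimes>\<^bsub>?L\<^esub> p = p \<otimes>\<^bsub>?L\<^esub> lamp S m)"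
    using S by (intro bex_cong refl) (metis inv_closed inv_solve_right lamp_in_carrier m_closed)
  also have "\<dots> \<longleftrightarrow> (\<exists>k \<theta>. finite \<theta> \<and> g = lamp (sym_diff ((+) k ` S) (coboundary m \<theta>)) m)"
  proof (intro iffI; elim bexE exE conjE)
    fix p assume p: "p \<in> carrier ?L" and g: "g \<in> carrier ?L"
      and eq: "g \<otimes>\<^bsub>?L\<^esub> p = p \<otimes>\<^bsub>?L\<^esub> lamp S m"
    obtain \<theta> k where \<theta>: "p = lamp \<theta> k" "finite \<theta>" using p by (auto simp: carrier_lamplighter_group)
    obtain T n where T: "g = lamp T n" "finite T" using g by (auto simp: carrier_lamplighter_group)
    from eq have "n = m" "sym_diff T ((+) m ` \<theta>) = sym_diff \<theta> ((+) k ` S)"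
      by (auto simp: T \<theta> mult_lamp)
    then have "T = sym_diff ((+) k ` S) (coboundary m \<theta>)"
      unfolding coboundary_def by blast
    with \<theta> T \<open>n = m\<close> show "\<exists>k \<theta>. finite \<theta> \<and> g = lamp (sym_diff ((+) k ` S) (coboundary m \<theta>)) m"
      by blast
  next
    fix k \<theta> assume \<theta>: "finite \<theta>" and g: "g = lamp (sym_diff ((+) k ` S) (coboundary m \<theta>)) m"
    have "g \<otimes>\<^bsub>?L\<^esub> lamp \<theta> k = lamp \<theta> k \<otimes>\<^bsub>?L\<^esub> lamp S m"
      unfolding g mult_lamp lamp_eq_iff coboundary_def by (auto simp: add.commute)
    moreover have "g \<in> carrier ?L" using S \<theta> by (simp add: g coboundary_def)
    ultimately show "\<exists>p\<in>carrier ?L. g \<in> carrier ?L \<and> g \<otimes>\<^bsub>?L\<^esub> p = p \<otimes>\<^bsub>?L\<^esub> lamp S m"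
      using \<theta> by (intro bexI[of _ "lamp \<theta> k"]) auto
  qed
  finally show ?thesis .
qed

lemma lamp_class_eq_iff_mem:
  assumes "finite S" "finite T"
  shows "lamp_class S m = lamp_class T n \<longleftrightarrow> lamp T n \<in> lamp_class S m"
proof -
  let ?L = lamplighter_group
  interpret group ?L by (rule group_lamplighter_group)
  interpret C: group_action ?L "carrier ?L" "\<lambda>g. \<lambda>h\<in>carrier ?L. g \<otimes>\<^bsub>?L\<^esub> h \<otimes>\<^bsub>?L\<^esub> inv\<^bsub>?L\<^esub> g"
    by (rule action_by_conjugation)
  have refl: "lamp T n \<in> lamp_class T n"
    unfolding lamp_class_def using assms by (intro C.orbit_refl) auto
  show ?thesis
  proof
    assume "lamp T n \<in> lamp_class S m"
    moreover have "lamp_class S m \<in> conjugacy_classes ?L" "lamp_class T n \<in> conjugacy_classes ?L"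
      using assms by (auto simp: conjugacy_classes_lamp)
    ultimately show "lamp_class S m = lamp_class T n"
      using refl C.disjoint_union unfolding conjugacy_classes_def by blast
  qed (use refl in simp)
qed

lemma lamp_class_eq_iff:
  assumes "finite S" "finite T"
  shows "lamp_class S m = lamp_class T n \<longleftrightarrow>
     n = m \<and> (\<exists>k \<theta>. finite \<theta> \<and> T = sym_diff ((+) k ` S) (coboundary m \<theta>))"
  using assms by (auto simp: lamp_class_eq_iff_mem mem_lamp_class_iff)

lemma finite_coboundary [simp]: "finite \<theta> \<Longrightarrow> finite (coboundary m \<theta>)"
  by (simp add: coboundary_def)

lemma coboundary_sym_diff:
  "coboundary m (sym_diff S T) = sym_diff (coboundary m S) (coboundary m T)"
proof -
  have "(+) m ` sym_diff S T = sym_diff ((+) m ` S) ((+) m ` T)"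
    by (simp add: set_eq_iff mem_translate_iff)
  then show ?thesis unfolding coboundary_def by blast
qed

text \<open>
  The invariant of a class with cursor \<open>m \<noteq> 0\<close>: the residue classes modulo \<open>m\<close> that contain an odd
  number of lit lamps. Encoding them as an \<open>m\<close>-periodic set of integers, rather than as a subset of
  \<open>{0..<\<bar>m\<bar>}\<close>, makes rotations of necklaces into plain translations.
\<close>

definition residue_parity :: "int \<Rightarrow> int set \<Rightarrow> int set" where
  "residue_parity m S = {r. odd (card {i \<in> S. m dvd i - r})}"

lemma odd_card_sym_diff:
  assumes "finite A" "finite B"
  shows "odd (card (sym_diff A B)) \<longleftrightarrow> odd (card A) \<noteq> odd (card B)"
proof -
  have "card (sym_diff A B) = card (A - B) + card (B - A)"
    using assms by (intro card_Un_disjoint) auto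
  moreover have "card A = card (A - B) + card (A \<inter> B)" "card B = card (B - A) + card (A \<inter> B)"
    using assms by (auto simp: card_Diff_subset_Int Int_commute card_mono)
  ultimately show ?thesis by presburger
qed

lemma residue_parity_sym_diff:
  assumes "finite S" "finite T"
  shows "residue_parity m (sym_diff S T) = sym_diff (residue_parity m S) (residue_parity m T)"
proof -
  have "{i \<in> sym_diff S T. m dvd i - r} = sym_diff {i \<in> S. m dvd i - r} {i \<in> T. m dvd i - r}" for r
    by auto
  then show ?thesis
    using assms by (auto simp: residue_parity_def odd_card_sym_diff)
qed

lemma residue_parity_translate: "residue_parity m ((+) k ` S) = (+) k ` residue_parity m S"
proof (rule Set.set_eqI)
  fix r
  have "{i \<in> (+) k ` S. m dvd i - r} = (+) k ` {i \<in> S. m dvd i - (r - k)}"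
    by (auto simp: algebra_simps)
  then show "r \<in> residue_parity m ((+) k ` S) \<longleftrightarrow> r \<in> (+) k ` residue_parity m S"
    by (simp add: residue_parity_def card_image mem_translate_iff)
qed

lemma dvd_shift_iff: "m dvd i - (r + m) \<longleftrightarrow> m dvd i - r" for m :: int
  using dvd_add_right_iff[of m m "i - (r + m)"] by simp

lemma residue_parity_periodic: "r + m \<in> residue_parity m S \<longleftrightarrow> r \<in> residue_parity m S"
  by (simp add: residue_parity_def dvd_shift_iff)

lemma translate_residue_parity: "(+) m ` residue_parity m S = residue_parity m S"
  using residue_parity_periodic[of "_ - m" m S] by (simp add: set_eq_iff mem_translate_iff)

lemma residue_parity_coboundary:
  "finite \<theta> \<Longrightarrow> residue_parity m (coboundary m \<theta>) = {}"
  by (simp add: coboundary_def residue_parity_sym_diff residue_parity_translate translate_residue_parity)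

text \<open>
  A single lamp can be moved by any multiple of \<open>m\<close> within the conjugacy class.
\<close>

lemma sym_diff_residue_shift_coboundary:
  "\<exists>\<theta>. finite \<theta> \<and> sym_diff {p} {p + j * m} = coboundary m \<theta>"
proof (induction j rule: int_induct[where k = 0])
  case base
  then show ?case by (intro exI[of _ "{}"]) (simp add: coboundary_def)
next
  case (step1 j)
  then obtain \<theta> where \<theta>: "finite \<theta>" "sym_diff {p} {p + j * m} = coboundary m \<theta>" by blast
  have "coboundary m {p + j * m} = sym_diff {p + j * m} {p + (j + 1) * m}"
    by (simp add: coboundary_def algebra_simps)
  then have "coboundary m (sym_diff \<theta> {p + j * m}) = sym_diff {p} {p + (j + 1) * m}"
    unfolding coboundary_sym_diff \<theta>(2)[symmetric] by blast
  then show ?case using \<theta>(1) by (intro exI[of _ "sym_diff \<theta> {p + j * m}"]) simp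
next
  case (step2 j)
  then obtain \<theta> where \<theta>: "finite \<theta>" "sym_diff {p} {p + j * m} = coboundary m \<theta>" by blast
  have "coboundary m {p + (j - 1) * m} = sym_diff {p + (j - 1) * m} {p + j * m}"
    by (simp add: coboundary_def algebra_simps)
  then have "coboundary m (sym_diff \<theta> {p + (j - 1) * m}) = sym_diff {p} {p + (j - 1) * m}"
    unfolding coboundary_sym_diff \<theta>(2)[symmetric] by blast
  then show ?case using \<theta>(1) by (intro exI[of _ "sym_diff \<theta> {p + (j - 1) * m}"]) simp
qed

lemma dvd_minus_iff_mod_eq:
  assumes "m \<noteq> (0::int)" "i \<in> {0..<\<bar>m\<bar>}"
  shows "m dvd i - r \<longleftrightarrow> i = r mod \<bar>m\<bar>"
proof -
  have "m dvd i - r \<longleftrightarrow> \<bar>m\<bar> dvd i - r" by simp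
  also have "\<dots> \<longleftrightarrow> i mod \<bar>m\<bar> = r mod \<bar>m\<bar>" by (simp only: mod_eq_dvd_iff)
  also have "i mod \<bar>m\<bar> = i" using assms by simp
  finally show ?thesis .
qed

lemma mem_shift_multiple:
  fixes m :: int
  assumes per: "\<And>r. r + m \<in> P \<longleftrightarrow> r \<in> P"
  shows "r + j * m \<in> P \<longleftrightarrow> r \<in> P"
proof (induction j rule: int_induct[where k = 0])
  case (step1 j)
  then show ?case using per[of "r + j * m"] by (simp add: algebra_simps)
next
  case (step2 j)
  then show ?case using per[of "r + (j - 1) * m"] by (simp add: algebra_simps)
qed simp

lemma mod_abs_shift:
  obtains j where "p mod \<bar>m\<bar> = p + j * (m::int)"
proof -
  have "\<bar>m\<bar> dvd p mod \<bar>m\<bar> - p" by (simp add: mod_eq_dvd_iff[symmetric])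
  then have "m dvd p mod \<bar>m\<bar> - p" by simp
  then obtain j where "p mod \<bar>m\<bar> - p = m * j" by (rule dvdE)
  then show ?thesis by (intro that[of j]) (simp add: algebra_simps)
qed

text \<open>
  Moving every lamp into \<open>{0..<\<bar>m\<bar>}\<close>, where lamps cancel in pairs, leaves exactly the odd residue
  classes. In particular a configuration all of whose residue parities are even is a coboundary.
\<close>

lemma sym_diff_window_residue_parity:
  assumes m: "m \<noteq> 0" and "finite S"
  shows "\<exists>\<theta>. finite \<theta> \<and> sym_diff S (residue_parity m S \<inter> {0..<\<bar>m\<bar>}) = coboundary m \<theta>"
  using \<open>finite S\<close>
proof (induction S)
  case empty
  then show ?case by (intro exI[of _ "{}"]) (simp add: coboundary_def residue_parity_def)
next
  case (insert p S)
  let ?W = "\<lambda>S. residue_parity m S \<inter> {0..<\<bar>m\<bar>}"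
  obtain \<theta> where \<theta>: "finite \<theta>" "sym_diff S (?W S) = coboundary m \<theta>"
    using insert.IH by blast
  have ins: "insert p S = sym_diff S {p}" using insert.hyps by auto
  have "{i \<in> {p}. m dvd i - r} = (if m dvd p - r then {p} else {})" for r by auto
  then have "residue_parity m {p} = {r. m dvd r - p}"
    by (auto simp: residue_parity_def dvd_diff_commute)
  moreover have "p mod \<bar>m\<bar> \<in> {0..<\<bar>m\<bar>}" using m by simp
  ultimately have "?W {p} = {p mod \<bar>m\<bar>}"
    using dvd_minus_iff_mod_eq[OF m, of _ p] by blast
  then have W: "?W (insert p S) = sym_diff (?W S) {p mod \<bar>m\<bar>}"
    unfolding ins using insert.hyps by (subst residue_parity_sym_diff) auto
  obtain j where "p mod \<bar>m\<bar> = p + j * m" by (rule mod_abs_shift)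
  with sym_diff_residue_shift_coboundary[of p j m]
  obtain \<theta>' where \<theta>': "finite \<theta>'" "sym_diff {p} {p mod \<bar>m\<bar>} = coboundary m \<theta>'"
    by auto
  have rearrange: "sym_diff (sym_diff A B) (sym_diff C D) = sym_diff (sym_diff A C) (sym_diff B D)"
    for A B C D :: "int set" by blast
  have "sym_diff (insert p S) (?W (insert p S)) = coboundary m (sym_diff \<theta> \<theta>')"
    unfolding coboundary_sym_diff W \<theta>(2)[symmetric] \<theta>'(2)[symmetric]
    unfolding ins by (rule rearrange)
  then show ?case using \<theta>(1) \<theta>'(1) by (intro exI[of _ "sym_diff \<theta> \<theta>'"]) simp
qed

text \<open>
  So the conjugacy classes with cursor \<open>m\<close> are the binary necklaces with \<open>\<bar>m\<bar>\<close> beads: conjugation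
  by lamp configurations leaves only the residue parities, and conjugation by the cursor rotates
  them.
\<close>

theorem lamp_class_eq_iff_residue_parity:
  assumes m: "m \<noteq> 0" and fin: "finite S" "finite T"
  shows "lamp_class S m = lamp_class T m \<longleftrightarrow>
           (\<exists>k. residue_parity m T = (+) k ` residue_parity m S)"
proof
  assume "lamp_class S m = lamp_class T m"
  then have "\<exists>k \<theta>. finite \<theta> \<and> T = sym_diff ((+) k ` S) (coboundary m \<theta>)"
    by (simp only: lamp_class_eq_iff[OF fin])
  then obtain k \<theta> where "finite \<theta>" "T = sym_diff ((+) k ` S) (coboundary m \<theta>)"
    by (elim exE conjE)
  then have "residue_parity m T = (+) k ` residue_parity m S"
    using fin by (simp add: residue_parity_sym_diff residue_parity_coboundary residue_parity_translate)
  then show "\<exists>k. residue_parity m T = (+) k ` residue_parity m S" ..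
next
  assume "\<exists>k. residue_parity m T = (+) k ` residue_parity m S"
  then obtain k where k: "residue_parity m T = (+) k ` residue_parity m S" ..
  let ?D = "sym_diff ((+) k ` S) T"
  have "residue_parity m ?D = {}"
    using fin by (simp add: residue_parity_sym_diff residue_parity_translate k)
  then obtain \<theta> where "finite \<theta>" "?D = coboundary m \<theta>"
    using sym_diff_window_residue_parity[OF m, of ?D] fin by auto
  moreover from this have "T = sym_diff ((+) k ` S) (coboundary m \<theta>)" by blast
  ultimately show "lamp_class S m = lamp_class T m"
    unfolding lamp_class_eq_iff[OF fin] by (intro conjI refl exI[of _ k] exI[of _ \<theta>])
qed

lemma residue_parity_window:
  assumes m: "m \<noteq> 0" and per: "\<And>r. r + m \<in> P \<longleftrightarrow> r \<in> P"
  shows "residue_parity m (P \<inter> {0..<\<bar>m\<bar>}) = P"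
proof -
  have "r mod \<bar>m\<bar> \<in> P \<longleftrightarrow> r \<in> P" for r
    by (rule mod_abs_shift[of r m]) (simp add: mem_shift_multiple[OF per])
  moreover have "{i \<in> P \<inter> {0..<\<bar>m\<bar>}. m dvd i - r} = (if r mod \<bar>m\<bar> \<in> P then {r mod \<bar>m\<bar>} else {})" for r
  proof -
    have "r mod \<bar>m\<bar> \<in> {0..<\<bar>m\<bar>}" using m by simp
    then show ?thesis using dvd_minus_iff_mod_eq[OF m, of _ r] by (cases "r mod \<bar>m\<bar> \<in> P") force+
  qed
  ultimately show ?thesis by (auto simp: residue_parity_def)
qed

section \<open>Word lengths of conjugacy classes\<close>

text \<open>
  Here \<open>{lo..hi}\<close> is the range that the cursor visits; it contains the start \<open>0\<close>, the end \<open>m\<close>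
  and all lit lamps. A walk from \<open>0\<close> to \<open>m\<close> that reaches both ends of the range crosses every
  edge of it at least twice, except for at most \<open>\<bar>m\<bar>\<close> edges that it crosses once; each lit
  lamp costs one more letter. The word is read from its last letter, so a new letter multiplies from the left and
  translates the range.
\<close>

lemma word_spread:
  assumes "set ws \<subseteq> lamplighter_gens"
  shows "\<exists>S m lo hi. foldr (\<otimes>\<^bsub>lamplighter_group\<^esub>) ws \<one>\<^bsub>lamplighter_group\<^esub> = lamp S m \<and>
           S \<subseteq> {lo..hi} \<and> lo \<le> 0 \<and> 0 \<le> hi \<and> lo \<le> m \<and> m \<le> hi \<and>
           2 * (hi - lo) - \<bar>m\<bar> + int (card S) \<le> int (length ws)"
  using assms
proof (induction ws)
  case Nil
  then show ?case by (intro exI[of _ "{}"] exI[of _ 0]) (simp add: one_lamp)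
next
  case (Cons w ws)
  then obtain S m lo hi where IH:
      "foldr (\<otimes>\<^bsub>lamplighter_group\<^esub>) ws \<one>\<^bsub>lamplighter_group\<^esub> = lamp S m"
      "S \<subseteq> {lo..hi}" "lo \<le> 0" "0 \<le> hi" "lo \<le> m" "m \<le> hi"
      "2 * (hi - lo) - \<bar>m\<bar> + int (card S) \<le> int (length ws)" by auto
  have w: "w = lamp {} 1 \<or> w = lamp {} (-1) \<or> w = lamp {0} 0"
    using Cons.prems by (auto simp: lamplighter_gens_def lamp_def fun_eq_iff)
  have card: "card ((+) k ` S) = card S" for k by (simp add: card_image)
  from w show ?case
  proof (elim disjE)
    assume w: "w = lamp {} 1"
    have "(+) 1 ` S \<subseteq> {min 0 (lo + 1)..hi + 1}" using IH(2) by force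
    moreover have "2 * (hi + 1 - min 0 (lo + 1)) - \<bar>m + 1\<bar> \<le> 2 * (hi - lo) - \<bar>m\<bar> + 1"
      using IH(3-6) by (auto simp: min_def abs_if)
    then have "2 * (hi + 1 - min 0 (lo + 1)) - \<bar>m + 1\<bar> + int (card S) \<le> int (length ws) + 1"
      using IH(7) by linarith
    ultimately show ?thesis using IH(1,3-6) card[of 1]
      by (intro exI[of _ "(+) 1 ` S"] exI[of _ "m + 1"] exI[of _ "min 0 (lo + 1)"] exI[of _ "hi + 1"])
         (simp add: w mult_lamp add.commute)
  next
    assume w: "w = lamp {} (-1)"
    have "(+) (-1) ` S \<subseteq> {lo - 1..max 0 (hi - 1)}" using IH(2) by force
    moreover have "2 * (max 0 (hi - 1) - (lo - 1)) - \<bar>m - 1\<bar> \<le> 2 * (hi - lo) - \<bar>m\<bar> + 1"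
      using IH(3-6) by (auto simp: max_def abs_if)
    then have "2 * (max 0 (hi - 1) - (lo - 1)) - \<bar>m - 1\<bar> + int (card S) \<le> int (length ws) + 1"
      using IH(7) by linarith
    ultimately show ?thesis using IH(1,3-6) card[of "-1"]
      by (intro exI[of _ "(+) (-1) ` S"] exI[of _ "m - 1"] exI[of _ "lo - 1"] exI[of _ "max 0 (hi - 1)"])
         (simp add: w mult_lamp)
  next
    assume w: "w = lamp {0} 0"
    have fin: "finite S" using IH(2) by (rule finite_subset) simp
    have "card (sym_diff {0} S) \<le> card (insert 0 S)" using fin by (intro card_mono) auto
    also have "\<dots> \<le> Suc (card S)" using fin by (simp add: card_insert_if)
    finally have "card (sym_diff {0} S) \<le> Suc (card S)" .
    moreover have "sym_diff {0} S \<subseteq> {lo..hi}" using IH by auto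
    ultimately show ?thesis using IH
      by (intro exI[of _ "sym_diff {0} S"] exI[of _ m] exI[of _ lo] exI[of _ hi])
         (simp add: w mult_lamp)
  qed
qed

abbreviation class_len :: "((int \<Rightarrow> int) \<times> int) set \<Rightarrow> nat" where
  "class_len \<equiv> class_length lamplighter_group lamplighter_gens"

lemma class_len_attained:
  assumes "finite S"
  obtains T lo hi where "finite T" "lamp_class T m = lamp_class S m" "T \<subseteq> {lo..hi}"
    "lo \<le> 0" "0 \<le> hi" "lo \<le> m" "m \<le> hi"
    "2 * (hi - lo) - \<bar>m\<bar> + int (card T) \<le> int (class_len (lamp_class S m))"
proof -
  let ?L = lamplighter_group and ?Y = lamplighter_gens
  have "lamp S m \<in> lamp_class S m" using assms by (simp flip: lamp_class_eq_iff_mem)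
  then have "\<exists>n. \<exists>g\<in>lamp_class S m. word_length ?L ?Y g = n" by blast
  from LeastI_ex[OF this] obtain g where
    g: "g \<in> lamp_class S m" "word_length ?L ?Y g = class_len (lamp_class S m)"
    unfolding class_length_def by blast
  obtain T where T: "g = lamp T m" "finite T"
    using g(1) assms by (auto simp: mem_lamp_class_iff)
  have "\<exists>n ws. set ws \<subseteq> ?Y \<and> length ws = n \<and> foldr (\<otimes>\<^bsub>?L\<^esub>) ws \<one>\<^bsub>?L\<^esub> = g"
    using lamplighter_gens_generate[of g] T by auto
  from LeastI_ex[OF this] obtain ws where ws: "set ws \<subseteq> ?Y" "length ws = class_len (lamp_class S m)"
      "foldr (\<otimes>\<^bsub>?L\<^esub>) ws \<one>\<^bsub>?L\<^esub> = g"
    using g(2) unfolding word_length_def by auto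
  from word_spread[OF ws(1)] obtain lo hi where "T \<subseteq> {lo..hi}"
    "lo \<le> 0" "0 \<le> hi" "lo \<le> m" "m \<le> hi"
    "2 * (hi - lo) - \<bar>m\<bar> + int (card T) \<le> int (class_len (lamp_class S m))"
    unfolding ws T by auto
  moreover have "lamp_class T m = lamp_class S m"
    using g(1) T assms by (metis lamp_class_eq_iff_mem)
  ultimately show ?thesis using that T(2) by blast
qed

lemma class_len_le_word:
  assumes "finite S" "set ws \<subseteq> lamplighter_gens"
    and "foldr (\<otimes>\<^bsub>lamplighter_group\<^esub>) ws \<one>\<^bsub>lamplighter_group\<^esub> = lamp S m"
  shows "class_len (lamp_class S m) \<le> length ws"
proof -
  let ?L = lamplighter_group and ?Y = lamplighter_gens
  have "word_length ?L ?Y (lamp S m) \<le> length ws"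
    unfolding word_length_def using assms by (intro Least_le) auto
  moreover have "lamp S m \<in> lamp_class S m" using assms by (simp flip: lamp_class_eq_iff_mem)
  then have "class_len (lamp_class S m) \<le> word_length ?L ?Y (lamp S m)"
    unfolding class_length_def by (intro Least_le) auto
  ultimately show ?thesis by simp
qed

text \<open>
  Let the cursor walk from \<open>0\<close> to \<open>n\<close> and switch the lamps of \<open>S\<close> on its way.
\<close>

lemma class_len_le:
  assumes "S \<subseteq> {0..<int n}"
  shows "class_len (lamp_class S (int n)) \<le> n + card S"
proof -
  let ?L = lamplighter_group and ?Y = lamplighter_gens
  have "\<exists>ws. set ws \<subseteq> ?Y \<and> length ws = n + card S \<and> foldr (\<otimes>\<^bsub>?L\<^esub>) ws \<one>\<^bsub>?L\<^esub> = lamp S (int n)"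
    using assms
  proof (induction n arbitrary: S)
    case 0
    then show ?case by (intro exI[of _ "[]"]) (simp add: one_lamp)
  next
    case (Suc n)
    define T where "T = (+) (-1) ` (S - {0})"
    have "T \<subseteq> {0..<int n}" using Suc.prems by (force simp: T_def)
    from Suc.IH[OF this] obtain ws where ws: "set ws \<subseteq> ?Y" "length ws = n + card T"
      "foldr (\<otimes>\<^bsub>?L\<^esub>) ws \<one>\<^bsub>?L\<^esub> = lamp T (int n)" by blast
    have gens: "lamp {} 1 \<in> ?Y" "lamp {0} 0 \<in> ?Y"
      by (auto simp: lamplighter_gens_def lamp_def fun_eq_iff)
    have fin: "finite S" using Suc.prems by (rule finite_subset) simp
    have T: "(+) 1 ` T = S - {0}" by (simp add: T_def image_image)
    have cT: "card T = card (S - {0})" by (simp add: T_def card_image)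
    show ?case
    proof (cases "0 \<in> S")
      case True
      then have "sym_diff {0} (S - {0}) = S" by blast
      moreover have "card S = Suc (card T)" using True fin unfolding cT by (metis card_Suc_Diff1 fin)
      ultimately show ?thesis using ws gens
        by (intro exI[of _ "lamp {0} 0 # lamp {} 1 # ws"]) (simp add: mult_lamp T)
    next
      case False
      then have "S - {0} = S" by blast
      then show ?thesis using ws gens cT
        by (intro exI[of _ "lamp {} 1 # ws"]) (simp add: mult_lamp T)
    qed
  qed
  moreover have "finite S" using assms by (rule finite_subset) simp
  ultimately show ?thesis using class_len_le_word by metis
qed

lemma card_window_translate:
  fixes n k :: int
  assumes n: "n > 0" and per: "\<And>r. r + n \<in> P \<longleftrightarrow> r \<in> P"
  shows "card ((+) k ` P \<inter> {0..<n}) = card (P \<inter> {0..<n})"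
proof -
  have md: "r mod n \<in> P \<longleftrightarrow> r \<in> P" for r
    using mem_shift_multiple[OF per, of "r mod n" "r div n"] by simp
  have "bij_betw (\<lambda>r. (r + k) mod n) (P \<inter> {0..<n}) ((+) k ` P \<inter> {0..<n})"
  proof (rule bij_betw_byWitness[where f' = "\<lambda>r. (r - k) mod n"])
    have "(r + k) mod n - k \<in> P \<longleftrightarrow> r \<in> P" for r
      using md[of r] md[of "(r + k) mod n - k"] by (simp add: mod_diff_left_eq)
    then show "(\<lambda>r. (r + k) mod n) ` (P \<inter> {0..<n}) \<subseteq> (+) k ` P \<inter> {0..<n}"
      using n by (auto simp: mem_translate_iff)
    show "(\<lambda>r. (r - k) mod n) ` ((+) k ` P \<inter> {0..<n}) \<subseteq> P \<inter> {0..<n}"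
      using n by (auto simp: md mem_translate_iff)
  qed (use n in \<open>auto simp: mod_diff_left_eq mod_add_left_eq\<close>)
  then show ?thesis by (metis bij_betw_same_card)
qed

text \<open>
  The length of a necklace is at least its number of beads plus its number of odd beads: every odd
  residue class must contain a lit lamp, whichever representative is chosen.
\<close>

lemma class_len_ge:
  assumes m: "m \<noteq> 0" and S: "finite S"
  shows "nat \<bar>m\<bar> + card (residue_parity m S \<inter> {0..<\<bar>m\<bar>}) \<le> class_len (lamp_class S m)"
proof -
  obtain T lo hi where T: "finite T" "lamp_class T m = lamp_class S m" "T \<subseteq> {lo..hi}"
    "lo \<le> 0" "0 \<le> hi" "lo \<le> m" "m \<le> hi"
    "2 * (hi - lo) - \<bar>m\<bar> + int (card T) \<le> int (class_len (lamp_class S m))"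
    using class_len_attained[OF S] by metis
  obtain k where k: "residue_parity m T = (+) k ` residue_parity m S"
    using T S m by (metis lamp_class_eq_iff_residue_parity)
  have "r + \<bar>m\<bar> \<in> residue_parity m S \<longleftrightarrow> r \<in> residue_parity m S" for r
    using residue_parity_periodic[of r "\<bar>m\<bar>" S] by (simp add: residue_parity_def)
  then have "card (residue_parity m S \<inter> {0..<\<bar>m\<bar>}) = card (residue_parity m T \<inter> {0..<\<bar>m\<bar>})"
    unfolding k using m by (intro card_window_translate[symmetric]) auto
  also have "\<dots> \<le> card T"
  proof (rule surj_card_le[OF T(1), of _ "\<lambda>i. i mod \<bar>m\<bar>"], rule subsetI)
    fix r assume r: "r \<in> residue_parity m T \<inter> {0..<\<bar>m\<bar>}"
    then have "{i \<in> T. m dvd i - r} \<noteq> {}" by (auto simp: residue_parity_def simp del: Collect_empty_eq)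
    then obtain i where i: "i \<in> T" "m dvd r - i" by (auto simp: dvd_diff_commute)
    then show "r \<in> (\<lambda>i. i mod \<bar>m\<bar>) ` T"
      using dvd_minus_iff_mod_eq[OF m, of r i] r by blast
  qed
  finally have "int (card (residue_parity m S \<inter> {0..<\<bar>m\<bar>})) \<le> int (card T)" by simp
  moreover have "\<bar>m\<bar> \<le> hi - lo" using T(4-7) by linarith
  ultimately have "\<bar>m\<bar> + int (card (residue_parity m S \<inter> {0..<\<bar>m\<bar>})) \<le> int (class_len (lamp_class S m))"
    using T(8) by simp
  then have "int (nat \<bar>m\<bar> + card (residue_parity m S \<inter> {0..<\<bar>m\<bar>})) \<le> int (class_len (lamp_class S m))"
    by simp
  then show ?thesis by (simp only: of_nat_le_iff)
qed

section \<open>Weights of binary words and their rotations\<close>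

lemma sum_power_card_Pow:
  fixes y :: "'a :: comm_semiring_1"
  assumes "finite A"
  shows "(\<Sum>B\<in>Pow A. y ^ card B) = (1 + y) ^ card A"
  using prod_add[OF assms, of "\<lambda>_. y" "\<lambda>_. 1"] by (simp add: add.commute)

text \<open>
  Every bead contributes weight \<open>x\<close> if it is even and \<open>x\<^sup>2\<close> if it is odd.
\<close>

lemma sum_weights_window:
  fixes x :: "'a :: comm_semiring_1"
  shows "(\<Sum>W\<in>Pow {0..<int n}. x ^ (n + card W)) = (x + x\<^sup>2) ^ n"
proof -
  have "(\<Sum>W\<in>Pow {0..<int n}. x ^ (n + card W)) = x ^ n * (1 + x) ^ n"
    by (simp add: power_add sum_power_card_Pow flip: sum_distrib_left)
  then show ?thesis by (simp add: power_mult_distrib[symmetric] power2_eq_square algebra_simps)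
qed

definition periodic_extension :: "nat \<Rightarrow> int set \<Rightarrow> int set" where
  "periodic_extension n W = {r. r mod int n \<in> W}"

lemma periodic_extension_window:
  "W \<subseteq> {0..<int n} \<Longrightarrow> periodic_extension n W \<inter> {0..<int n} = W"
  by (auto simp: periodic_extension_def)

lemma residue_parity_eq_periodic_extension:
  assumes m: "m \<noteq> 0" and W: "W \<subseteq> {0..<\<bar>m\<bar>}"
  shows "residue_parity m W = periodic_extension (nat \<bar>m\<bar>) W"
proof -
  have per: "r + m \<in> periodic_extension (nat \<bar>m\<bar>) W \<longleftrightarrow> r \<in> periodic_extension (nat \<bar>m\<bar>) W" for r
  proof -
    have "(r + m) mod \<bar>m\<bar> = r mod \<bar>m\<bar>" by (simp add: mod_eq_dvd_iff)
    then show ?thesis by (simp add: periodic_extension_def)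
  qed
  from residue_parity_window[OF m this] periodic_extension_window[of W "nat \<bar>m\<bar>"] W
  show ?thesis by simp
qed

lemma lamp_class_eq_iff_windows:
  assumes m: "m \<noteq> 0" and W: "W \<subseteq> {0..<\<bar>m\<bar>}" "W' \<subseteq> {0..<\<bar>m\<bar>}"
  defines "P \<equiv> periodic_extension (nat \<bar>m\<bar>)"
  shows "lamp_class W m = lamp_class W' m \<longleftrightarrow> (\<exists>k. P W' = (+) k ` P W)"
proof -
  have "finite W" "finite W'" using W by (auto intro: finite_subset)
  then show ?thesis
    using m W by (simp add: P_def lamp_class_eq_iff_residue_parity residue_parity_eq_periodic_extension)
qed

definition cursor_classes :: "int \<Rightarrow> ((int \<Rightarrow> int) \<times> int) set set" where
  "cursor_classes m = {lamp_class S m | S. finite S}"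

lemma cursor_classes_windows:
  assumes m: "m \<noteq> 0"
  shows "cursor_classes m = (\<lambda>W. lamp_class W m) ` Pow {0..<\<bar>m\<bar>}"
  unfolding cursor_classes_def
proof (intro equalityI subsetI)
  fix C assume "C \<in> {lamp_class S m | S. finite S}"
  then obtain S where S: "C = lamp_class S m" "finite S" by blast
  let ?W = "residue_parity m S \<inter> {0..<\<bar>m\<bar>}"
  have "residue_parity m ?W = residue_parity m S"
    by (rule residue_parity_window[OF m residue_parity_periodic])
  then have "residue_parity m ?W = (+) 0 ` residue_parity m S" by simp
  then have "\<exists>k. residue_parity m ?W = (+) k ` residue_parity m S" by (rule exI)
  moreover have "finite ?W" by simp
  ultimately have "C = lamp_class ?W m"
    unfolding S(1) using lamp_class_eq_iff_residue_parity[OF m S(2)] by metis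
  then show "C \<in> (\<lambda>W. lamp_class W m) ` Pow {0..<\<bar>m\<bar>}" by blast
qed (auto intro: finite_subset)

lemma translate_translate: "(+) j ` (+) k ` P = (+) (j + k) ` P" for j k :: int
  by (auto simp: set_eq_iff mem_translate_iff algebra_simps)

lemma translate_mod_periodic_extension:
  "(+) (k mod int n) ` periodic_extension n W = (+) k ` periodic_extension n W"
  by (auto simp: set_eq_iff mem_translate_iff periodic_extension_def mod_diff_right_eq)

text \<open>
  A subset of \<open>{0..<n}\<close> is read as a binary word of length \<open>n\<close>. It is primitive if its \<open>n\<close>
  rotations are distinct, that is, if its periodic extension has least period \<open>n\<close>.
\<close>

definition primitive_window :: "nat \<Rightarrow> int set \<Rightarrow> bool" where
  "primitive_window n W \<longleftrightarrow>
     (\<forall>k\<in>{0<..<int n}. (+) k ` periodic_extension n W \<noteq> periodic_extension n W)"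

text \<open>
  The words that represent a given class form a single orbit under rotation. Thus a class has at most
  \<open>\<bar>m\<bar>\<close> of them, and exactly \<open>\<bar>m\<bar>\<close> if they are primitive.
\<close>

lemma class_windows_eq_rotations:
  fixes m :: int
  assumes m: "m \<noteq> 0" and W: "W \<subseteq> {0..<\<bar>m\<bar>}"
  shows "{W' \<in> Pow {0..<\<bar>m\<bar>}. lamp_class W' m = lamp_class W m} =
    (\<lambda>k. (+) k ` periodic_extension (nat \<bar>m\<bar>) W \<inter> {0..<\<bar>m\<bar>}) ` {0..<\<bar>m\<bar>}"
    (is "?A = ?r ` _")
proof (intro equalityI subsetI)
  let ?P = "periodic_extension (nat \<bar>m\<bar>)"
  fix W' assume W': "W' \<in> ?A"
  then obtain k where "?P W' = (+) k ` ?P W"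
    using lamp_class_eq_iff_windows[OF m W, of W'] by auto
  then have "?P W' = (+) (k mod \<bar>m\<bar>) ` ?P W"
    using translate_mod_periodic_extension[of k "nat \<bar>m\<bar>" W] by simp
  then have "W' = ?r (k mod \<bar>m\<bar>)"
    using W' periodic_extension_window[of W' "nat \<bar>m\<bar>"] by auto
  then show "W' \<in> ?r ` {0..<\<bar>m\<bar>}" using m by simp
next
  let ?P = "periodic_extension (nat \<bar>m\<bar>)"
  fix W' assume "W' \<in> ?r ` {0..<\<bar>m\<bar>}"
  then obtain k where k: "W' = ?r k" by blast
  have "r mod \<bar>m\<bar> \<in> (+) k ` ?P W \<longleftrightarrow> r \<in> (+) k ` ?P W" for r
    by (simp add: mem_translate_iff periodic_extension_def mod_diff_left_eq)
  then have "?P W' = (+) k ` ?P W" using m by (auto simp: k periodic_extension_def[of _ "?r k"])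
  then show "W' \<in> ?A"
    using lamp_class_eq_iff_windows[OF m W, of W'] by (auto simp: k)
qed

lemma card_class_windows_le:
  fixes m :: int
  assumes m: "m \<noteq> 0" and W: "W \<subseteq> {0..<\<bar>m\<bar>}"
  shows "card {W' \<in> Pow {0..<\<bar>m\<bar>}. lamp_class W' m = lamp_class W m} \<le> nat \<bar>m\<bar>"
  unfolding class_windows_eq_rotations[OF m W]
  by (rule order_trans[OF card_image_le]) simp_all

lemma card_class_windows_primitive:
  fixes m :: int
  assumes m: "m \<noteq> 0" and W: "W \<subseteq> {0..<\<bar>m\<bar>}" and prim: "primitive_window (nat \<bar>m\<bar>) W"
  shows "card {W' \<in> Pow {0..<\<bar>m\<bar>}. lamp_class W' m = lamp_class W m} = nat \<bar>m\<bar>"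
proof -
  let ?P = "periodic_extension (nat \<bar>m\<bar>) W"
  let ?r = "\<lambda>k. (+) k ` ?P \<inter> {0..<\<bar>m\<bar>}"
  have md: "r mod \<bar>m\<bar> \<in> (+) k ` ?P \<longleftrightarrow> r \<in> (+) k ` ?P" for r k
    by (simp add: mem_translate_iff periodic_extension_def mod_diff_left_eq)
  have ext: "(+) k ` ?P = {r. r mod \<bar>m\<bar> \<in> ?r k}" for k
    using md[of _ k] m by (auto simp: set_eq_iff)
  have less: "\<not> j < k" if "j \<in> {0..<\<bar>m\<bar>}" "k \<in> {0..<\<bar>m\<bar>}" "?r j = ?r k" for j k
  proof
    assume "j < k"
    have "(+) j ` ?P = (+) k ` ?P" using that(3) ext by metis
    then have "(+) (-j) ` (+) j ` ?P = (+) (-j) ` (+) k ` ?P" by (rule arg_cong)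
    then have "(+) (k - j) ` ?P = ?P" unfolding translate_translate by simp
    with prim \<open>j < k\<close> that(1,2) show False by (auto simp: primitive_window_def)
  qed
  have "inj_on ?r {0..<\<bar>m\<bar>}"
  proof (rule inj_onI)
    fix j k assume "j \<in> {0..<\<bar>m\<bar>}" "k \<in> {0..<\<bar>m\<bar>}" "?r j = ?r k"
    with less[of j k] less[of k j] have "\<not> j < k" "\<not> k < j" by simp_all
    then show "j = k" by simp
  qed
  then show ?thesis unfolding class_windows_eq_rotations[OF m W] by (simp add: card_image)
qed

lemma translate_eq_self_iff:
  "(+) p ` P = P \<longleftrightarrow> (\<forall>r. r + p \<in> P \<longleftrightarrow> r \<in> P)" for p :: int
proof -
  have "(+) p ` P = P \<longleftrightarrow> (\<forall>r. r - p \<in> P \<longleftrightarrow> r \<in> P)"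
    by (simp add: set_eq_iff mem_translate_iff)
  also have "\<dots> \<longleftrightarrow> (\<forall>r. r + p \<in> P \<longleftrightarrow> r \<in> P)"
    by (metis add_diff_cancel_right' diff_add_cancel)
  finally show ?thesis .
qed

text \<open>
  The periods of a set form a subgroup, so a period \<open>k\<close> together with \<open>n\<close> yields the period
  \<open>gcd k n\<close>.
\<close>

lemma imprimitive_window_period:
  assumes "\<not> primitive_window n W"
  obtains d where "d dvd n" "0 < d" "d < n"
    "(+) (int d) ` periodic_extension n W = periodic_extension n W"
proof -
  let ?P = "periodic_extension n W"
  obtain k where k: "0 < k" "k < int n" "\<And>r. r + k \<in> ?P \<longleftrightarrow> r \<in> ?P"
    using assms by (auto simp: primitive_window_def translate_eq_self_iff)
  have n: "r + int n \<in> ?P \<longleftrightarrow> r \<in> ?P" for r by (simp add: periodic_extension_def)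
  obtain u v where uv: "u * k + v * int n = gcd k (int n)" using bezout_int by blast
  have "r + gcd k (int n) \<in> ?P \<longleftrightarrow> r \<in> ?P" for r
    using mem_shift_multiple[OF n, of "r + u * k" v] mem_shift_multiple[OF k(3), of r u]
    by (simp add: add.assoc flip: uv)
  then have "(+) (gcd k (int n)) ` ?P = ?P" by (simp add: translate_eq_self_iff)
  moreover have "nat (gcd k (int n)) < n" using k gcd_le1_int[of k "int n"] by linarith
  moreover have "gcd k (int n) > 0" using k by simp
  moreover have "nat (gcd k (int n)) dvd n"
    by (metis gcd_dvd2 gcd_ge_0_int int_dvd_int_iff int_nat_eq)
  ultimately show ?thesis using k by (intro that[of "nat (gcd k (int n))"]) auto
qed

text \<open>
  A word of length \<open>n\<close> with period \<open>d\<close> is the \<open>q\<close>-fold repetition of its first \<open>d\<close> letters, so its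
  weight is the weight of a word of length \<open>d\<close> at the argument \<open>x ^ q\<close>.
\<close>

lemma sum_weights_period_le:
  fixes x :: real
  assumes x: "0 \<le> x" and n: "n = q * d" and d: "0 < d"
  shows "(\<Sum>W | W \<subseteq> {0..<int n} \<and> (+) (int d) ` periodic_extension n W = periodic_extension n W.
            x ^ (n + card W)) \<le> (x ^ q + x ^ (2 * q)) ^ d"
proof -
  let ?P = "periodic_extension n"
  define V where "V = {W. W \<subseteq> {0..<int n} \<and> (+) (int d) ` ?P W = ?P W}"
  let ?U = "\<lambda>W. W \<inter> {0..<int d}"
  have mod_d: "r \<in> W \<longleftrightarrow> r mod int d \<in> W" if W: "W \<in> V" and r: "r \<in> {0..<int n}" for r W
  proof -
    have "r + int d \<in> ?P W \<longleftrightarrow> r \<in> ?P W" for r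
      using W by (simp add: V_def translate_eq_self_iff)
    from mem_shift_multiple[OF this, of "r mod int d" "r div int d"]
    have "r \<in> ?P W \<longleftrightarrow> r mod int d \<in> ?P W" by simp
    moreover have "r mod int d \<in> {0..<int n}"
      using r d zmod_le_nonneg_dividend[of r "int d"] by auto
    ultimately show ?thesis using r by (simp add: periodic_extension_def)
  qed
  have inj: "inj_on ?U V"
  proof (rule inj_onI, rule Set.set_eqI)
    fix W W' r assume *: "W \<in> V" "W' \<in> V" "?U W = ?U W'"
    have "r mod int d \<in> {0..<int d}" using d by simp
    with *(3) have "r mod int d \<in> W \<longleftrightarrow> r mod int d \<in> W'" by blast
    with mod_d[OF *(1), of r] mod_d[OF *(2), of r] * show "r \<in> W \<longleftrightarrow> r \<in> W'"
      by (auto simp: V_def)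
  qed
  have card: "card W = q * card (?U W)" if W: "W \<in> V" for W
  proof -
    have "bij_betw (\<lambda>(u, j). u + int j * int d) (?U W \<times> {..<q}) W"
    proof (rule bij_betw_byWitness[where f' = "\<lambda>r. (r mod int d, nat (r div int d))"])
      show "(\<lambda>(u, j). u + int j * int d) ` (?U W \<times> {..<q}) \<subseteq> W"
      proof clarify
        fix u j assume u: "u \<in> W" "u \<in> {0..<int d}" and j: "j < q"
        have "u + int j * int d < int (Suc j) * int d" using u by (simp add: algebra_simps)
        also have "\<dots> \<le> int q * int d" using j by (intro mult_right_mono) auto
        finally have "u + int j * int d \<in> {0..<int n}" using u by (simp add: n)
        from mod_d[OF W this] u show "u + int j * int d \<in> W" by simp
      qed
      show "(\<lambda>r. (r mod int d, nat (r div int d))) ` W \<subseteq> ?U W \<times> {..<q}"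
      proof (rule image_subsetI)
        fix r assume r: "r \<in> W"
        then have rn: "r \<in> {0..<int n}" using W by (auto simp: V_def)
        have "int d * (r div int d) \<le> r" using d by (simp add: minus_mod_eq_mult_div[symmetric])
        also have "r < int d * int q" using rn by (simp add: n mult.commute)
        finally have "r div int d < int q" using d by simp
        then show "(r mod int d, nat (r div int d)) \<in> ?U W \<times> {..<q}"
          using mod_d[OF W rn] r d rn by (auto simp: nat_less_iff pos_imp_zdiv_nonneg_iff)
      qed
    qed (use W d in \<open>auto simp: V_def pos_imp_zdiv_nonneg_iff subset_iff\<close>)
    from bij_betw_same_card[OF this] show ?thesis by (simp add: card_cartesian_product mult.commute)
  qed
  have "(\<Sum>W\<in>V. x ^ (n + card W)) = (\<Sum>W\<in>V. (x ^ q) ^ (d + card (?U W)))"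
    by (rule sum.cong) (simp_all add: card n flip: power_mult, simp add: algebra_simps)
  also have "\<dots> = (\<Sum>U\<in>?U ` V. (x ^ q) ^ (d + card U))"
    by (subst sum.reindex[OF inj]) simp
  also have "\<dots> \<le> (\<Sum>U\<in>Pow {0..<int d}. (x ^ q) ^ (d + card U))"
    using x by (intro sum_mono2) auto
  also have "\<dots> = (x ^ q + x ^ (2 * q)) ^ d"
    unfolding sum_weights_window by (simp add: mult.commute flip: power_mult)
  finally show ?thesis by (simp add: V_def)
qed

lemma sum_UN_le:
  fixes f :: "'a \<Rightarrow> real"
  assumes "finite I" "\<And>i. i \<in> I \<Longrightarrow> finite (A i)" "\<And>a. 0 \<le> f a"
  shows "sum f (\<Union>i\<in>I. A i) \<le> (\<Sum>i\<in>I. sum f (A i))"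
proof -
  have "sum f (\<Union>i\<in>I. A i) \<le> (\<Sum>(i, a)\<in>Sigma I A. f a)"
    using assms by (intro sum_le_included[where i = snd]) (auto intro!: finite_SigmaI)
  also have "\<dots> = (\<Sum>i\<in>I. sum f (A i))"
    using assms by (intro sum.Sigma[symmetric]) auto
  finally show ?thesis .
qed

text \<open>
  An imprimitive word is a \<open>q\<close>-fold repetition with \<open>q \<ge> 2\<close>, and the words with a fixed \<open>q\<close> and
  \<open>d = n div q\<close> weigh at most \<open>x ^ n * (1 + x ^ q) ^ d\<close>, where \<open>(1 + x ^ q) ^ d\<close> is at most
  \<open>(1 + x\<^sup>2) ^ (n / 2)\<close>. The factor \<open>n\<close> bounds the number of divisors. What matters is that the
  base \<open>x * sqrt (1 + x\<^sup>2)\<close> stays below \<open>1\<close> where \<open>x + x\<^sup>2\<close> reaches \<open>1\<close>.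
\<close>

lemma sum_weights_imprimitive_le:
  fixes x :: real
  assumes x: "0 \<le> x" "x \<le> 1"
  shows "(\<Sum>W | W \<subseteq> {0..<int n} \<and> \<not> primitive_window n W. x ^ (n + card W))
           \<le> real n * (x * sqrt (1 + x\<^sup>2)) ^ n"
proof -
  let ?V = "\<lambda>d. {W. W \<subseteq> {0..<int n} \<and> (+) (int d) ` periodic_extension n W = periodic_extension n W}"
  let ?D = "{d. d dvd n \<and> 0 < d \<and> d < n}"
  let ?I = "{W. W \<subseteq> {0..<int n} \<and> \<not> primitive_window n W}"
  have finV: "finite (?V d)" for d
    by (rule finite_subset[of _ "Pow {0..<int n}"]) auto
  have finD: "finite ?D" by simp
  have "?I \<subseteq> (\<Union>d\<in>?D. ?V d)"
    using imprimitive_window_period by (smt (verit) UN_iff mem_Collect_eq subsetI)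
  then have "(\<Sum>W\<in>?I. x ^ (n + card W)) \<le> (\<Sum>W\<in>(\<Union>d\<in>?D. ?V d). x ^ (n + card W))"
    using x finV finD by (intro sum_mono2) auto
  also have "\<dots> \<le> (\<Sum>d\<in>?D. \<Sum>W\<in>?V d. x ^ (n + card W))"
    using x by (intro sum_UN_le finD finV) auto
  also have "\<dots> \<le> (\<Sum>d\<in>?D. (x * sqrt (1 + x\<^sup>2)) ^ n)"
  proof (rule sum_mono)
    fix d assume d: "d \<in> ?D"
    then obtain q where q: "n = q * d" by (auto elim: dvdE simp: mult.commute)
    have q2: "2 \<le> q"
    proof (rule ccontr)
      assume "\<not> 2 \<le> q"
      then have "q = 0 \<or> q = 1" by linarith
      with q d show False by auto
    qed
    have "(\<Sum>W\<in>?V d. x ^ (n + card W)) \<le> (x ^ q + x ^ (2 * q)) ^ d"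
      using sum_weights_period_le[OF x(1) q] d by simp
    also have "x ^ q + x ^ (2 * q) = x ^ q * (1 + x ^ q)"
      by (simp only: mult_2 power_add distrib_left mult_1_right)
    also have "(x ^ q * (1 + x ^ q)) ^ d = x ^ n * (1 + x ^ q) ^ d"
      by (simp add: power_mult_distrib q power_mult)
    also have "(1 + x ^ q) ^ d \<le> (1 + x\<^sup>2) ^ d"
      using x q2 by (intro power_mono add_left_mono power_decreasing) auto
    also have "(1 + x\<^sup>2) ^ d = sqrt (1 + x\<^sup>2) ^ (2 * d)"
      by (simp add: power_mult)
    also have "\<dots> \<le> sqrt (1 + x\<^sup>2) ^ n"
      using q q2 by (intro power_increasing) auto
    finally show "(\<Sum>W\<in>?V d. x ^ (n + card W)) \<le> (x * sqrt (1 + x\<^sup>2)) ^ n"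
      using x by (simp add: power_mult_distrib mult_left_mono)
  qed
  also have "\<dots> = real (card ?D) * (x * sqrt (1 + x\<^sup>2)) ^ n" by simp
  also have "\<dots> \<le> real n * (x * sqrt (1 + x\<^sup>2)) ^ n"
  proof (intro mult_right_mono)
    have "card ?D \<le> card {..<n}" by (intro card_mono) auto
    then show "real (card ?D) \<le> real n" by simp
  qed (use x in simp)
  finally show ?thesis .
qed

section \<open>Bounds for the conjugacy growth series\<close>

lemma conjugacy_classes_eq_UN: "conjugacy_classes lamplighter_group = (\<Union>m. cursor_classes m)"
  by (auto simp: conjugacy_classes_lamp cursor_classes_def)

lemma finite_cursor_classes: "m \<noteq> 0 \<Longrightarrow> finite (cursor_classes m)"
  by (simp add: cursor_classes_windows)

lemma cursor_classes_disjoint: "m \<noteq> n \<Longrightarrow> cursor_classes m \<inter> cursor_classes n = {}"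
  by (auto simp: cursor_classes_def lamp_class_eq_iff)

lemma class_len_window_ge:
  assumes m: "m \<noteq> 0" and W: "W \<subseteq> {0..<\<bar>m\<bar>}"
  shows "nat \<bar>m\<bar> + card W \<le> class_len (lamp_class W m)"
proof -
  have "finite W" using W by (rule finite_subset) simp
  moreover have "residue_parity m W \<inter> {0..<\<bar>m\<bar>} = W"
    using W periodic_extension_window[of W "nat \<bar>m\<bar>"]
    by (simp add: residue_parity_eq_periodic_extension[OF m W])
  ultimately show ?thesis using class_len_ge[OF m, of W] by simp
qed

lemma class_len_ge_cursor:
  assumes "C \<in> cursor_classes m" "m \<noteq> 0"
  shows "nat \<bar>m\<bar> \<le> class_len C"
proof -
  obtain W where "C = lamp_class W m" "W \<subseteq> {0..<\<bar>m\<bar>}"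
    using assms by (auto simp: cursor_classes_windows)
  with class_len_window_ge[OF assms(2), of W] show ?thesis by simp
qed

text \<open>
  A class whose words are primitive is represented by \<open>n\<close> words, so each of them accounts for an
  \<open>n\<close>-th of its weight; the imprimitive words are few enough to be counted in full.
\<close>

lemma sum_cursor_classes_le:
  fixes x :: real
  assumes m: "m \<noteq> 0" and x: "0 \<le> x" "x \<le> 1" and n: "n = nat \<bar>m\<bar>"
  shows "(\<Sum>C\<in>cursor_classes m. x ^ class_len C)
           \<le> (x + x\<^sup>2) ^ n / real n + real n * (x * sqrt (1 + x\<^sup>2)) ^ n"
proof -
  let ?V = "Pow {0..<\<bar>m\<bar>}" and ?cl = "\<lambda>W. lamp_class W m" and ?w = "\<lambda>W. x ^ (n + card W)"
  have npos: "n > 0" and mn: "\<bar>m\<bar> = int n" using m by (auto simp: n)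
  \<comment> \<open>The share of \<open>W\<close> in an upper bound for the weight of its class.\<close>
  define h where "h W = ?w W / real n + (if primitive_window n W then 0 else ?w W)" for W
  have hpos: "0 \<le> h W" for W using x by (simp add: h_def)
  have fin: "finite ?V" by simp
  have le: "x ^ class_len C \<le> (\<Sum>W | W \<in> ?V \<and> ?cl W = C. h W)" if "C \<in> ?cl ` ?V" for C
  proof -
    obtain W0 where W0: "W0 \<in> ?V" "C = ?cl W0" using \<open>C \<in> ?cl ` ?V\<close> by blast
    let ?A = "{W. W \<in> ?V \<and> ?cl W = C}"
    have finA: "finite ?A" by (rule finite_subset[OF _ fin]) auto
    have w: "x ^ class_len C \<le> ?w W" if "W \<in> ?A" for W
      using that x class_len_window_ge[OF m, of W] by (intro power_decreasing) (auto simp: n)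
    show ?thesis
    proof (cases "primitive_window n W0")
      case True
      then have "card ?A = n"
        using card_class_windows_primitive[OF m, of W0] W0 by (simp add: n)
      then have "x ^ class_len C = (\<Sum>W\<in>?A. x ^ class_len C / real n)" using npos by simp
      also have "\<dots> \<le> (\<Sum>W\<in>?A. h W)"
      proof (rule sum_mono)
        fix W assume "W \<in> ?A"
        from w[OF this] have "x ^ class_len C / real n \<le> ?w W / real n"
          by (rule divide_right_mono) simp
        also have "\<dots> \<le> h W" using x by (simp add: h_def)
        finally show "x ^ class_len C / real n \<le> h W" .
      qed
      finally show ?thesis .
    next
      case False
      have W0A: "W0 \<in> ?A" using W0 by simp
      have "x ^ class_len C \<le> ?w W0" by (rule w[OF W0A])
      also have "\<dots> \<le> h W0" using x False by (simp add: h_def)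
      also have "\<dots> \<le> (\<Sum>W\<in>?A. h W)" using finA W0A hpos by (intro member_le_sum) auto
      finally show ?thesis .
    qed
  qed
  have "(\<Sum>C\<in>cursor_classes m. x ^ class_len C) \<le> (\<Sum>C\<in>?cl ` ?V. \<Sum>W | W \<in> ?V \<and> ?cl W = C. h W)"
    unfolding cursor_classes_windows[OF m] by (intro sum_mono le)
  also have "\<dots> = (\<Sum>W\<in>?V. h W)"
    by (rule sum.image_gen[OF fin, symmetric])
  also have "\<dots> = (\<Sum>W\<in>?V. ?w W) / real n + (\<Sum>W\<in>?V. if primitive_window n W then 0 else ?w W)"
    by (simp add: h_def sum.distrib sum_divide_distrib)
  also have "(\<Sum>W\<in>?V. ?w W) = (x + x\<^sup>2) ^ n"
    unfolding mn by (rule sum_weights_window)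
  also have "(\<Sum>W\<in>?V. if primitive_window n W then 0 else ?w W) =
      (\<Sum>W | W \<subseteq> {0..<int n} \<and> \<not> primitive_window n W. ?w W)"
    unfolding mn by (intro sum.mono_neutral_cong_right) auto
  also have "\<dots> \<le> real n * (x * sqrt (1 + x\<^sup>2)) ^ n"
    by (rule sum_weights_imprimitive_le[OF x])
  finally show ?thesis by simp
qed

lemma sum_cursor_classes_ge:
  fixes x :: real
  assumes n: "n > 0" and x: "0 \<le> x" "x \<le> 1"
  shows "(x + x\<^sup>2) ^ n / real n \<le> (\<Sum>C\<in>cursor_classes (int n). x ^ class_len C)"
proof -
  let ?V = "Pow {0..<int n}" and ?cl = "\<lambda>W. lamp_class W (int n)" and ?w = "\<lambda>W. x ^ (n + card W)"
  have n0: "int n \<noteq> 0" using n by simp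
  have "(x + x\<^sup>2) ^ n = (\<Sum>W\<in>?V. ?w W)" by (rule sum_weights_window[symmetric])
  also have "\<dots> = (\<Sum>C\<in>?cl ` ?V. \<Sum>W | W \<in> ?V \<and> ?cl W = C. ?w W)"
    by (rule sum.image_gen) simp
  also have "\<dots> \<le> (\<Sum>C\<in>?cl ` ?V. real n * x ^ class_len C)"
  proof (rule sum_mono)
    fix C assume "C \<in> ?cl ` ?V"
    then obtain W0 where W0: "W0 \<in> ?V" "C = ?cl W0" by blast
    let ?A = "{W. W \<in> ?V \<and> ?cl W = C}"
    have "(\<Sum>W\<in>?A. ?w W) \<le> real (card ?A) * x ^ class_len C"
    proof (rule sum_bounded_above)
      fix W assume "W \<in> ?A"
      then show "?w W \<le> x ^ class_len C"
        using x class_len_le[of W n] by (intro power_decreasing) auto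
    qed
    also have "card ?A \<le> n"
      using card_class_windows_le[OF n0, of W0] W0 by simp
    then have "real (card ?A) * x ^ class_len C \<le> real n * x ^ class_len C"
      using x by (intro mult_right_mono) auto
    finally show "(\<Sum>W\<in>?A. ?w W) \<le> real n * x ^ class_len C" .
  qed
  also have "\<dots> = real n * (\<Sum>C\<in>cursor_classes (int n). x ^ class_len C)"
    using cursor_classes_windows[OF n0] by (simp add: sum_distrib_left)
  finally show ?thesis using n by (simp add: field_simps)
qed

text \<open>
  For cursor \<open>0\<close> the walk is closed, so a range of length \<open>r\<close> costs the factor \<open>x ^ (2 * r)\<close>
  besides the factor \<open>x\<close> for each lit lamp. The bound \<open>x\<^sup>2 * (1 + x) \<le> x\<close> shows that these classes
  contribute only a bounded amount.
\<close>

lemma sum_cursor_0_classes_le: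
  fixes x :: real
  assumes x: "0 \<le> x" "x + x\<^sup>2 \<le> 1"
  shows "(\<Sum>C | C \<in> cursor_classes 0 \<and> class_len C < N. x ^ class_len C) \<le> 2 * (\<Sum>r<N. x ^ r)"
proof -
  have x1: "x \<le> 1" using x by (smt (verit) zero_le_power2)
  let ?B = "{C \<in> cursor_classes 0. class_len C < N}"
  let ?T = "SIGMA r : {..<N}. Pow {0..int r}"
  have ex: "\<exists>y\<in>?T. lamp_class (snd y) 0 = C \<and> x ^ class_len C \<le> (\<lambda>(r, T). x ^ (2 * r + card T)) y"
    if C: "C \<in> ?B" for C
  proof -
    obtain S where S: "C = lamp_class S 0" "finite S" using C by (auto simp: cursor_classes_def)
    obtain T lo hi where T: "finite T" "lamp_class T 0 = lamp_class S 0" "T \<subseteq> {lo..hi}"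
      "lo \<le> 0" "0 \<le> hi" "2 * (hi - lo) - \<bar>0\<bar> + int (card T) \<le> int (class_len C)"
      using class_len_attained[OF S(2), of 0] S(1) by metis
    define r where "r = nat (hi - lo)"
    have r: "int r = hi - lo" using T by (simp add: r_def)
    let ?T' = "(+) (- lo) ` T"
    have "lamp_class T 0 = lamp_class ?T' 0"
      unfolding lamp_class_eq_iff[OF T(1) finite_imageI[OF T(1)]]
      by (intro conjI refl exI[of _ "-lo"] exI[of _ "{}"]) (simp_all add: coboundary_def)
    then have cl: "lamp_class ?T' 0 = C" using T(2) S(1) by simp
    have len: "2 * r + card ?T' \<le> class_len C"
    proof -
      have "int (2 * r + card T) \<le> int (class_len C)" using T(6) r by simp
      then show ?thesis by (simp add: card_image)
    qed
    have "?T' \<subseteq> {0..int r}" using T(3) r by force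
    moreover have "r < N" using len C by simp
    moreover have "x ^ class_len C \<le> x ^ (2 * r + card ?T')"
      using len x x1 by (intro power_decreasing) auto
    ultimately show ?thesis using cl by (intro bexI[of _ "(r, ?T')"]) auto
  qed
  have finB: "finite ?B"
    by (rule finite_surj[of ?T _ "\<lambda>y. lamp_class (snd y) 0"]) (use ex in blast)+
  have "(\<Sum>C\<in>?B. x ^ class_len C) \<le> (\<Sum>(r, T)\<in>?T. x ^ (2 * r + card T))"
    using ex x finB by (intro sum_le_included[where i = "\<lambda>y. lamp_class (snd y) 0"]) auto
  also have "\<dots> = (\<Sum>r<N. \<Sum>T\<in>Pow {0..int r}. x ^ (2 * r + card T))"
    by (rule sum.Sigma[symmetric]) auto
  also have "\<dots> = (\<Sum>r<N. x ^ (2 * r) * (1 + x) ^ Suc r)"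
    by (rule sum.cong) (simp_all add: power_add sum_power_card_Pow nat_add_distrib flip: sum_distrib_left)
  also have "\<dots> \<le> (\<Sum>r<N. 2 * x ^ r)"
  proof (rule sum_mono)
    fix r
    have "x ^ (2 * r) * (1 + x) ^ Suc r = (1 + x) * (x ^ r * (x + x\<^sup>2) ^ r)"
      by (simp add: power_mult power2_eq_square algebra_simps flip: power_mult_distrib)
    also have "\<dots> \<le> 2 * (x ^ r * 1)"
      using x x1 by (intro mult_mono power_le_one) auto
    finally show "x ^ (2 * r) * (1 + x) ^ Suc r \<le> 2 * x ^ r" by simp
  qed
  finally show ?thesis by (simp add: sum_distrib_left)
qed

lemma sums_neg_ln_one_minus:
  fixes t :: real
  assumes "0 \<le> t" "t < 1"
  shows "(\<lambda>n. t ^ n / real n) sums (- ln (1 - t))"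
  using sums_minus[OF ln_series'[of "- t"]] assms by simp

abbreviation short_classes :: "nat \<Rightarrow> ((int \<Rightarrow> int) \<times> int) set set" where
  "short_classes N \<equiv> {C \<in> conjugacy_classes lamplighter_group. class_len C < N}"

lemma finite_short_classes: "finite (short_classes N)"
proof -
  have "short_classes N = (\<Union>n<N. {C \<in> conjugacy_classes lamplighter_group. class_len C = n})"
    by auto
  then show ?thesis by (simp add: finite_classes_of_length)
qed

text \<open>
  All classes except those with a primitive word contribute a bounded amount as long as \<open>x\<close>
  and \<open>s\<close> are bounded away from \<open>1\<close>; the primitive ones give the logarithmic series
  in \<open>x + x\<^sup>2\<close>, once for each sign of the cursor.
\<close>

lemma sum_short_classes_le:
  fixes x s :: real
  assumes x: "0 \<le> x" "x + x\<^sup>2 < 1" and s: "x * sqrt (1 + x\<^sup>2) \<le> s" "s < 1"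
  shows "(\<Sum>C\<in>short_classes N. x ^ class_len C)
           \<le> 2 / (1 - x) + 2 / (1 - s)\<^sup>2 - 2 * ln (1 - (x + x\<^sup>2))"
proof -
  let ?f = "\<lambda>C. x ^ class_len C"
  let ?B = "{C \<in> cursor_classes 0. class_len C < N}"
  let ?D = "\<lambda>n. cursor_classes (int n) \<union> cursor_classes (- int n)"
  define t where "t = x + x\<^sup>2"
  have x1: "x < 1" using x by (smt (verit) zero_le_power2)
  have t: "0 \<le> t" "t < 1" using x by (auto simp: t_def)
  have s0: "0 \<le> s" using x s by (smt (verit) mult_nonneg_nonneg real_sqrt_ge_zero zero_le_power2)
  have fin: "finite (?D n)" if "n \<in> {1..<N}" for n
    using that by (auto intro: finite_cursor_classes)
  have finB: "finite ?B"
    by (rule finite_subset[OF _ finite_short_classes[of N]]) (auto simp: conjugacy_classes_eq_UN)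
  have "short_classes N \<subseteq> ?B \<union> (\<Union>n\<in>{1..<N}. ?D n)"
  proof
    fix C assume C: "C \<in> short_classes N"
    then obtain m where m: "C \<in> cursor_classes m" "class_len C < N"
      by (auto simp: conjugacy_classes_eq_UN)
    show "C \<in> ?B \<union> (\<Union>n\<in>{1..<N}. ?D n)"
    proof (cases "m = 0")
      case False
      with class_len_ge_cursor[OF m(1)] m(2) have "nat \<bar>m\<bar> \<in> {1..<N}" by auto
      moreover have "C \<in> ?D (nat \<bar>m\<bar>)" using m(1) by (cases "m \<ge> 0") auto
      ultimately show ?thesis by blast
    qed (use m in auto)
  qed
  then have "sum ?f (short_classes N) \<le> sum ?f (?B \<union> (\<Union>n\<in>{1..<N}. ?D n))"
    using x fin finB by (intro sum_mono2) auto
  also have "\<dots> \<le> sum ?f ?B + sum ?f (\<Union>n\<in>{1..<N}. ?D n)"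
    using x fin finB by (subst sum_Un) (auto intro!: sum_nonneg)
  also have "sum ?f (\<Union>n\<in>{1..<N}. ?D n) \<le> (\<Sum>n\<in>{1..<N}. sum ?f (?D n))"
    using x by (intro sum_UN_le fin) auto
  also have "\<dots> \<le> (\<Sum>n\<in>{1..<N}. 2 * (t ^ n / real n + real n * s ^ n))"
  proof (rule sum_mono)
    fix n assume n: "n \<in> {1..<N}"
    have bound: "sum ?f (cursor_classes m) \<le> t ^ n / real n + real n * s ^ n"
      if m: "m \<noteq> 0" "n = nat \<bar>m\<bar>" for m
    proof -
      have "sum ?f (cursor_classes m) \<le> t ^ n / real n + real n * (x * sqrt (1 + x\<^sup>2)) ^ n"
        unfolding t_def using x x1 m by (intro sum_cursor_classes_le) auto
      also have "(x * sqrt (1 + x\<^sup>2)) ^ n \<le> s ^ n"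
        using x s by (intro power_mono) auto
      finally show ?thesis by (simp add: mult_left_mono)
    qed
    have "sum ?f (?D n) \<le> sum ?f (cursor_classes (int n)) + sum ?f (cursor_classes (- int n))"
      using x n finite_cursor_classes by (subst sum_Un) (auto intro!: sum_nonneg)
    also have "\<dots> \<le> 2 * (t ^ n / real n + real n * s ^ n)"
      using bound[of "int n"] bound[of "- int n"] n by simp
    finally show "sum ?f (?D n) \<le> 2 * (t ^ n / real n + real n * s ^ n)" .
  qed
  also have "\<dots> = 2 * (\<Sum>n\<in>{1..<N}. t ^ n / real n) + 2 * (\<Sum>n\<in>{1..<N}. real n * s ^ n)"
    by (simp only: distrib_left sum.distrib sum_distrib_left)
  also have "(\<Sum>n\<in>{1..<N}. t ^ n / real n) \<le> - ln (1 - t)"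
    using sums_neg_ln_one_minus[OF t] t
    by (subst sums_unique[of "\<lambda>n. t ^ n / real n"]) (auto intro!: sum_le_suminf sums_summable)
  also have "(\<Sum>n\<in>{1..<N}. real n * s ^ n) \<le> (\<Sum>n\<in>{1..<N}. real (Suc n) * s ^ n)"
    using s0 by (intro sum_mono mult_right_mono) auto
  also have "\<dots> \<le> 1 / (1 - s)\<^sup>2"
    using geometric_deriv_sums[of s] s0 s(2)
    by (subst sums_unique[of "\<lambda>n. real (Suc n) * s ^ n"]) (auto intro!: sum_le_suminf sums_summable)
  also have "sum ?f ?B \<le> 2 * (\<Sum>r<N. x ^ r)"
    using x by (intro sum_cursor_0_classes_le) auto
  also have "(\<Sum>r<N. x ^ r) \<le> 1 / (1 - x)"
    using geometric_sums[of x] x x1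
    by (subst sums_unique[of "\<lambda>r. x ^ r"]) (auto intro!: sum_le_suminf sums_summable)
  finally show ?thesis by (simp add: t_def)
qed

lemma sum_short_classes_ge:
  fixes x :: real
  assumes x: "0 \<le> x" "x \<le> 1"
  shows "(\<Sum>n\<in>{1..<N}. (x + x\<^sup>2) ^ n / real n) \<le> (\<Sum>C\<in>short_classes (2 * N). x ^ class_len C)"
proof -
  let ?f = "\<lambda>C. x ^ class_len C"
  have "(\<Sum>n\<in>{1..<N}. (x + x\<^sup>2) ^ n / real n) \<le> (\<Sum>n\<in>{1..<N}. sum ?f (cursor_classes (int n)))"
    using x by (intro sum_mono sum_cursor_classes_ge) auto
  also have "\<dots> = sum ?f (\<Union>n\<in>{1..<N}. cursor_classes (int n))"
    by (intro sum.UNION_disjoint[symmetric]) (auto intro!: finite_cursor_classes cursor_classes_disjoint)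
  also have "\<dots> \<le> sum ?f (short_classes (2 * N))"
  proof (rule sum_mono2[OF finite_short_classes])
    show "(\<Union>n\<in>{1..<N}. cursor_classes (int n)) \<subseteq> short_classes (2 * N)"
    proof (rule UN_least, rule subsetI)
      fix n C assume n: "n \<in> {1..<N}" and C: "C \<in> cursor_classes (int n)"
      then obtain W where W: "C = lamp_class W (int n)" "W \<subseteq> {0..<int n}"
        by (auto simp: cursor_classes_windows)
      have "card W \<le> n" using card_mono[OF _ W(2)] by simp
      then have "class_len C < 2 * N" using class_len_le[OF W(2)] n W(1) by simp
      with C show "C \<in> short_classes (2 * N)" by (auto simp: conjugacy_classes_eq_UN)
    qed
  qed (use x in simp)
  finally show ?thesis .
qed

lemma partial_sum_growth_series:
  fixes x :: real
  shows "(\<Sum>n<N. real_fps (conjugacy_growth_series lamplighter_group lamplighter_gens) $ n * x ^ n) =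
           (\<Sum>C\<in>short_classes N. x ^ class_len C)"
proof -
  let ?A = "\<lambda>n. {C \<in> conjugacy_classes lamplighter_group. class_len C = n}"
  have "short_classes N = (\<Union>n\<in>{..<N}. ?A n)" by auto
  then have "(\<Sum>C\<in>short_classes N. x ^ class_len C) = (\<Sum>n<N. \<Sum>C\<in>?A n. x ^ class_len C)"
    by (simp only:) (intro sum.UNION_disjoint; auto simp: finite_classes_of_length)
  also have "\<dots> = (\<Sum>n<N. real (card (?A n)) * x ^ n)" by simp
  finally show ?thesis by (simp add: real_fps_def conjugacy_growth_series_def)
qed

lemma tendsto_mult_power_ln_0:
  "((\<lambda>u::real. u * (K - 2 * ln u) ^ i) \<longlongrightarrow> 0) (at_right 0)"
proof -
  \<comment> \<open>Substitute \<open>u = exp (- v)\<close>.\<close>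
  have "((\<lambda>v. ((K + 2 * v) / v) ^ i * (v ^ i / exp v)) \<longlongrightarrow> 2 ^ i * 0) at_top"
  proof (intro tendsto_mult tendsto_power tendsto_power_div_exp_0)
    have "((\<lambda>v. K * inverse v + 2) \<longlongrightarrow> K * 0 + 2) at_top"
      by (intro tendsto_intros tendsto_inverse_0_at_top filterlim_ident)
    moreover have "eventually (\<lambda>v. K * inverse v + 2 = (K + 2 * v) / v) at_top"
      using eventually_gt_at_top[of 0] by eventually_elim (simp add: add_divide_distrib inverse_eq_divide)
    ultimately have "((\<lambda>v. (K + 2 * v) / v) \<longlongrightarrow> K * 0 + 2) at_top"
      by (rule Lim_transform_eventually)
    then show "((\<lambda>v. (K + 2 * v) / v) \<longlongrightarrow> 2) at_top" by simp
  qed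
  moreover have "eventually (\<lambda>v::real. ((K + 2 * v) / v) ^ i * (v ^ i / exp v) = (K + 2 * v) ^ i / exp v) at_top"
    using eventually_gt_at_top[of 0] by eventually_elim (simp only: power_divide, simp)
  ultimately have "((\<lambda>v. (K + 2 * v) ^ i / exp v) \<longlongrightarrow> 2 ^ i * 0) at_top"
    by (rule Lim_transform_eventually)
  moreover have "filterlim (\<lambda>u::real. - ln u) at_top (at_right 0)"
    using ln_at_0 by (simp add: filterlim_uminus_at_bot)
  ultimately have "((\<lambda>u. (K + 2 * (- ln u)) ^ i / exp (- ln u)) \<longlongrightarrow> 2 ^ i * 0) (at_right 0)"
    by (rule filterlim_compose)
  moreover have "eventually (\<lambda>u::real. (K + 2 * (- ln u)) ^ i / exp (- ln u) = u * (K - 2 * ln u) ^ i) (at_right 0)"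
    using eventually_at_right_less[of 0] by eventually_elim (simp add: exp_minus field_simps)
  ultimately have "((\<lambda>u. u * (K - 2 * ln u) ^ i) \<longlongrightarrow> 2 ^ i * 0) (at_right 0)"
    by (rule Lim_transform_eventually)
  then show ?thesis by simp
qed

theorem proposition5p1:
  shows "transcendental_over_rational_functions
           (conjugacy_growth_series lamplighter_group lamplighter_gens)"
proof -
  let ?f = "real_fps (conjugacy_growth_series lamplighter_group lamplighter_gens)"
  \<comment> \<open>The positive root of \<open>x + x\<^sup>2 = 1\<close>.\<close>
  define \<rho> :: real where "\<rho> = (sqrt 5 - 1) / 2"
  define s where "s = \<rho> * sqrt (1 + \<rho>\<^sup>2)"
  define K where "K = 2 / (1 - \<rho>) + 2 / (1 - s)\<^sup>2"
  have "2 < sqrt (5::real)" by (rule real_less_rsqrt) simp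
  moreover have "sqrt (5::real) < 3" by (rule real_less_lsqrt) simp_all
  ultimately have \<rho>: "1 / 2 < \<rho>" "\<rho> < 1" by (simp_all add: \<rho>_def)
  have \<rho>2: "\<rho>\<^sup>2 = 1 - \<rho>" by (simp add: \<rho>_def power2_eq_square field_simps)
  have "s\<^sup>2 = \<rho>\<^sup>2 * (1 + \<rho>\<^sup>2)" by (simp add: s_def power_mult_distrib)
  also have "\<dots> = 3 - 4 * \<rho>" unfolding \<rho>2 using \<rho>2 by (simp add: power2_eq_square algebra_simps)
  finally have "s\<^sup>2 < 1\<^sup>2" using \<rho> by simp
  then have s1: "s < 1" by (rule power_less_imp_less_base) simp
  \<comment> \<open>So the distance of \<open>x + x\<^sup>2\<close> to \<open>1\<close> is comparable to that of \<open>x\<close> to \<open>\<rho>\<close>.\<close>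
  have factor: "1 - (x + x\<^sup>2) = (\<rho> - x) * (x + \<rho> + 1)" for x
    using \<rho>2 by (simp add: power2_eq_square algebra_simps)
  have cnonneg: "0 \<le> ?f $ n" for n by (simp add: real_fps_def conjugacy_growth_series_def)
  have bounds: "x + x\<^sup>2 < 1 \<and>
      summable (\<lambda>n. ?f $ n * x ^ n) \<and>
      - ln (1 - (x + x\<^sup>2)) \<le> eval_fps ?f x \<and> eval_fps ?f x \<le> K - 2 * ln (1 - (x + x\<^sup>2))"
    if x: "0 < x" "x < \<rho>" for x
  proof -
    have "0 < 1 - (x + x\<^sup>2)" unfolding factor using x \<rho> by (intro mult_pos_pos) auto
    then have t: "x + x\<^sup>2 < 1" by simp
    have "x * sqrt (1 + x\<^sup>2) \<le> s"
      unfolding s_def using x by (intro mult_mono real_sqrt_le_mono add_left_mono power_mono) auto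
    from sum_short_classes_le[OF _ t this s1] x
    have "(\<Sum>n<N. ?f $ n * x ^ n) \<le> 2 / (1 - x) + 2 / (1 - s)\<^sup>2 - 2 * ln (1 - (x + x\<^sup>2))" for N
      by (simp add: partial_sum_growth_series)
    moreover have "2 / (1 - x) \<le> 2 / (1 - \<rho>)" using x \<rho> by (intro divide_left_mono) auto
    ultimately have up: "(\<Sum>n<N. ?f $ n * x ^ n) \<le> K - 2 * ln (1 - (x + x\<^sup>2))" for N
      unfolding K_def by (smt (verit))
    have nonneg: "0 \<le> ?f $ n * x ^ n" for n using cnonneg x by simp
    have sm: "summable (\<lambda>n. ?f $ n * x ^ n)"
      using nonneg up by (rule summableI_nonneg_bounded)
    have "(\<Sum>n<N. (x + x\<^sup>2) ^ n / real n) \<le> eval_fps ?f x" for N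
    proof -
      have "(\<Sum>n<N. (x + x\<^sup>2) ^ n / real n) = (\<Sum>n\<in>{1..<N}. (x + x\<^sup>2) ^ n / real n)"
        by (intro sum.mono_neutral_right) auto
      also have "\<dots> \<le> (\<Sum>n<2 * N. ?f $ n * x ^ n)"
        unfolding partial_sum_growth_series using x \<rho> by (intro sum_short_classes_ge) auto
      also have "\<dots> \<le> eval_fps ?f x"
        unfolding eval_fps_def using sm nonneg by (intro sum_le_suminf) auto
      finally show ?thesis .
    qed
    moreover have "(\<lambda>n. (x + x\<^sup>2) ^ n / real n) sums (- ln (1 - (x + x\<^sup>2)))"
      using x t by (intro sums_neg_ln_one_minus) auto
    ultimately have "- ln (1 - (x + x\<^sup>2)) \<le> eval_fps ?f x"
      unfolding sums_def by (intro LIMSEQ_le_const2) auto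
    moreover have "eval_fps ?f x \<le> K - 2 * ln (1 - (x + x\<^sup>2))"
      unfolding eval_fps_def using sm up by (intro suminf_le_const) auto
    ultimately show ?thesis using t sm by blast
  qed
  have near: "eventually (\<lambda>x. 0 < x \<and> x < \<rho>) (at_left \<rho>)"
    using eventually_at_left_real[of 0 \<rho>] \<rho> by (auto elim: eventually_mono)
  have u: "filterlim (\<lambda>x. 1 - (x + x\<^sup>2)) (at_right 0) (at_left \<rho>)"
    unfolding filterlim_at
  proof
    show "eventually (\<lambda>x. 1 - (x + x\<^sup>2) \<in> {0<..} \<and> 1 - (x + x\<^sup>2) \<noteq> 0) (at_left \<rho>)"
      using near by eventually_elim (use bounds in force)
    have "((\<lambda>x. 1 - (x + x\<^sup>2)) \<longlongrightarrow> 1 - (\<rho> + \<rho>\<^sup>2)) (at_left \<rho>)"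
      by (intro tendsto_intros)
    then show "((\<lambda>x. 1 - (x + x\<^sup>2)) \<longlongrightarrow> 0) (at_left \<rho>)" by (simp add: \<rho>2)
  qed
  show ?thesis
  proof (rule transcendental_if_logarithmic_blowup)
    show "0 < \<rho>" using \<rho> by simp
    show "ereal \<rho> \<le> fps_conv_radius ?f"
      unfolding fps_conv_radius_def
    proof (rule conv_radius_geI_ex)
      fix r assume "0 < r" "ereal r < ereal \<rho>"
      with bounds[of r] show "\<exists>z. norm z = r \<and> summable (\<lambda>n. ?f $ n * z ^ n)"
        by (intro exI[of _ r]) auto
    qed
    have "filterlim (\<lambda>x. - ln (1 - (x + x\<^sup>2))) at_top (at_left \<rho>)"
      using filterlim_compose[OF ln_at_0 u] by (simp add: filterlim_uminus_at_bot)
    moreover have "eventually (\<lambda>x. - ln (1 - (x + x\<^sup>2)) \<le> eval_fps ?f x) (at_left \<rho>)"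
      using near by eventually_elim (use bounds in blast)
    ultimately show "filterlim (eval_fps ?f) at_top (at_left \<rho>)"
      by (rule filterlim_at_top_mono)
    fix i
    show "((\<lambda>x. (\<rho> - x) * eval_fps ?f x ^ i) \<longlongrightarrow> 0) (at_left \<rho>)"
    proof (rule tendsto_sandwich[OF _ _ tendsto_const])
      show "((\<lambda>x. (1 - (x + x\<^sup>2)) * (K - 2 * ln (1 - (x + x\<^sup>2))) ^ i) \<longlongrightarrow> 0) (at_left \<rho>)"
        by (rule filterlim_compose[OF tendsto_mult_power_ln_0 u])
      have Fnonneg: "0 \<le> eval_fps ?f x" if "0 < x" "x < \<rho>" for x
        using bounds[OF that] cnonneg that
        unfolding eval_fps_def by (intro suminf_nonneg) auto
      show "eventually (\<lambda>x. 0 \<le> (\<rho> - x) * eval_fps ?f x ^ i) (at_left \<rho>)"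
        using near by eventually_elim (use Fnonneg in simp)
      show "eventually (\<lambda>x. (\<rho> - x) * eval_fps ?f x ^ i
          \<le> (1 - (x + x\<^sup>2)) * (K - 2 * ln (1 - (x + x\<^sup>2))) ^ i) (at_left \<rho>)"
        using near
      proof eventually_elim
        case (elim x)
        then have x: "0 < x" "x < \<rho>" by auto
        have "(\<rho> - x) * 1 \<le> 1 - (x + x\<^sup>2)"
          unfolding factor using x \<rho> by (intro mult_left_mono) auto
        then show ?case
          using bounds[OF x] Fnonneg[OF x] x by (intro mult_mono power_mono) auto
      qed
    qed
  qed
qed

end
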